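(* There is a polynomial time algorithm which decides, for a given digraph $D$ and natural numbers $k,\ell$, whether $D$ contains $k+\ell$ pairwise arc-disjoint spanning subdigraphs $D_1,\ldots,D_{k+\ell}$ such that $D_1,\ldots,D_k$ are antistrong and the underlying graphs $UG(D_{k+1}),\ldots,UG(D_{k+\ell})$ are connected.
   Context: Digraphs are finite and loopless. The underlying graph $UG(D)$ of a digraph $D$ is obtained by ignoring arc orientations and deleting one copy of each pair of parallel edges arising from 2-cycles. In a walk (in the underlying graph) an arc $vw$ is forward if traversed from $v$ to $w$ and backward if traversed from $w$ to $v$. An antidirected trail is a walk with no repeated arc whose arcs alternate between forward and backward; it is a forward antidirected trail if it begins and ends with a forward arc. A digraph is antistrong if it has at least three vertices and contains a forward antidirected $(x,y)$-trail for every pair of distinct vertices $x,y$. *)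

theory Defs
  imports
    "Graph_Theory.Digraph_Component"
    "HOL-Computational_Algebra.Polynomial"
    "HOL-Library.Disjoint_Sets"
    "HOL-Library.Log_Nat"
begin

section \<open>Antistrong digraphs\<close>

text \<open>
  A step of a walk in the underlying graph is an arc together with the direction in which it is
  traversed; \<^term>\<open>True\<close> stands for forward, that is, from tail to head.
\<close>

type_synonym 'b step = "'b \<times> bool"

definition step_from :: "('a, 'b) pre_digraph \<Rightarrow> 'b step \<Rightarrow> 'a" where
  "step_from D e = (if snd e then tail D (fst e) else head D (fst e))"

definition step_to :: "('a, 'b) pre_digraph \<Rightarrow> 'b step \<Rightarrow> 'a" where
  "step_to D e = (if snd e then head D (fst e) else tail D (fst e))"

fun underlying_walk :: "('a, 'b) pre_digraph \<Rightarrow> 'a \<Rightarrow> 'b step list \<Rightarrow> 'a \<Rightarrow> bool" where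
  "underlying_walk D x [] y \<longleftrightarrow> x = y \<and> x \<in> verts D"
| "underlying_walk D x (e # es) y \<longleftrightarrow>
     fst e \<in> arcs D \<and> step_from D e = x \<and> underlying_walk D (step_to D e) es y"

definition antidirected_trail :: "('a, 'b) pre_digraph \<Rightarrow> 'a \<Rightarrow> 'b step list \<Rightarrow> 'a \<Rightarrow> bool" where
  "antidirected_trail D x es y \<longleftrightarrow>
     underlying_walk D x es y \<and>
     distinct (map fst es) \<and>
     successively (\<lambda>e f. snd e \<noteq> snd f) es"

definition forward_antidirected_trail ::
    "('a, 'b) pre_digraph \<Rightarrow> 'a \<Rightarrow> 'b step list \<Rightarrow> 'a \<Rightarrow> bool" where
  "forward_antidirected_trail D x es y \<longleftrightarrow>
     antidirected_trail D x es y \<and> es \<noteq> [] \<and> snd (hd es) \<and> snd (last es)"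

definition antistrong :: "('a, 'b) pre_digraph \<Rightarrow> bool" where
  "antistrong D \<longleftrightarrow>
     3 \<le> card (verts D) \<and>
     (\<forall>x \<in> verts D. \<forall>y \<in> verts D. x \<noteq> y \<longrightarrow> (\<exists>es. forward_antidirected_trail D x es y))"

text \<open>
  The subdigraphs are numbered from 0. The library's \<^const>\<open>Digraph_Component.connected\<close> says
  that the underlying graph of its argument, obtained by \<^const>\<open>mk_symmetric\<close> (which forgets
  orientations and merges parallel arcs), is connected.
\<close>

definition has_arc_disjoint_subdigraphs :: "('a, 'b) pre_digraph \<Rightarrow> nat \<Rightarrow> nat \<Rightarrow> bool" where
  "has_arc_disjoint_subdigraphs D k l \<longleftrightarrow>
     (\<exists>H :: nat \<Rightarrow> ('a, 'b) pre_digraph.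
        (\<forall>i < k + l. spanning (H i) D) \<and>
        disjoint_family_on (\<lambda>i. arcs (H i)) {..<k + l} \<and>
        (\<forall>i < k. antistrong (H i)) \<and>
        (\<forall>i \<in> {k..<k + l}. Digraph_Component.connected (H i)))"


section \<open>Polynomial time\<close>

text \<open>
  Algorithms are programs of a random access machine in structured form: a while language whose
  variables are unbounded arrays of natural numbers (a scalar is an array used at index 0 only),
  with unit cost for every syntactic operation executed. The only arithmetic is addition and
  truncated subtraction. There is deliberately no multiplication: thus a program running for
  \<open>t\<close> steps only produces numbers with \<open>O(t)\<close> more bits than its input, and the machine is
  polynomially equivalent to Turing machines.
\<close>

type_synonym vname = string
type_synonym store = "vname \<Rightarrow> nat \<Rightarrow> nat"

datatype aexp = N nat | Sel vname aexp | Plus aexp aexp | Minus aexp aexp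

datatype bexp = Less aexp aexp | Neg bexp | Conj bexp bexp

datatype com =
    SKIP
  | Assign vname aexp aexp  \<comment> \<open>array, index, new value\<close>
  | Seq com com
  | Cond bexp com com
  | While bexp com

fun aval :: "aexp \<Rightarrow> store \<Rightarrow> nat" where
  "aval (N n) s = n"
| "aval (Sel x i) s = s x (aval i s)"
| "aval (Plus a b) s = aval a s + aval b s"
| "aval (Minus a b) s = aval a s - aval b s"

fun bval :: "bexp \<Rightarrow> store \<Rightarrow> bool" where
  "bval (Less a b) s \<longleftrightarrow> aval a s < aval b s"
| "bval (Neg b) s \<longleftrightarrow> \<not> bval b s"
| "bval (Conj b c) s \<longleftrightarrow> bval b s \<and> bval c s"

fun acost :: "aexp \<Rightarrow> nat" where
  "acost (N n) = 1"
| "acost (Sel x i) = acost i + 1"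
| "acost (Plus a b) = acost a + acost b + 1"
| "acost (Minus a b) = acost a + acost b + 1"

fun bcost :: "bexp \<Rightarrow> nat" where
  "bcost (Less a b) = acost a + acost b + 1"
| "bcost (Neg b) = bcost b + 1"
| "bcost (Conj b c) = bcost b + bcost c + 1"

text \<open>
  \<open>exec c s t s'\<close>: started in store \<open>s\<close>, program \<open>c\<close> terminates in store \<open>s'\<close> after exactly
  \<open>t\<close> steps.
\<close>

inductive exec :: "com \<Rightarrow> store \<Rightarrow> nat \<Rightarrow> store \<Rightarrow> bool" where
  Skip: "exec SKIP s 1 s"
| Assign: "exec (Assign x i a) s (acost i + acost a + 1) (s(x := (s x)(aval i s := aval a s)))"
| Seq: "exec c s t s' \<Longrightarrow> exec d s' u s'' \<Longrightarrow> exec (Seq c d) s (t + u) s''"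
| CondTrue: "bval b s \<Longrightarrow> exec c s t s' \<Longrightarrow> exec (Cond b c d) s (bcost b + 1 + t) s'"
| CondFalse: "\<not> bval b s \<Longrightarrow> exec d s t s' \<Longrightarrow> exec (Cond b c d) s (bcost b + 1 + t) s'"
| WhileFalse: "\<not> bval b s \<Longrightarrow> exec (While b c) s (bcost b + 1) s"
| WhileTrue: "bval b s \<Longrightarrow> exec c s t s' \<Longrightarrow> exec (While b c) s' u s'' \<Longrightarrow>
    exec (While b c) s (bcost b + 1 + t + u) s''"

inductive_cases SkipE: "exec SKIP s t s'"
  and AssignE: "exec (Assign x i a) s t s'"
  and SeqE: "exec (Seq c d) s t s'"
  and CondE: "exec (Cond b c d) s t s'"
  and WhileE: "exec (While b c) s t s'"

lemma exec_deterministic: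
  "exec c s t s' \<Longrightarrow> exec c s u s'' \<Longrightarrow> u = t \<and> s'' = s'"
proof (induction arbitrary: u s'' rule: exec.induct)
  case (Seq c s t s' d v r)
  from Seq.prems obtain t2 s2 v2 where *: "u = t2 + v2" "exec c s t2 s2" "exec d s2 v2 s''"
    by (elim SeqE)
  from Seq.IH(1)[OF *(2)] have "t2 = t" "s2 = s'" by simp_all
  with Seq.IH(2) * show ?case by simp
next
  case (CondTrue b s c t s' d)
  from CondTrue.prems CondTrue.hyps(1) show ?case
    by (elim CondE) (use CondTrue.IH in auto)
next
  case (CondFalse b s d t s' c)
  from CondFalse.prems CondFalse.hyps(1) show ?case
    by (elim CondE) (use CondFalse.IH in auto)
next
  case (WhileFalse b s c)
  from WhileFalse.prems show ?case
    by (rule WhileE) (use WhileFalse.hyps in auto)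
next
  case (WhileTrue b s c t s' v r)
  from WhileTrue.prems obtain t2 s2 v2
    where *: "u = Suc (bcost b + t2 + v2)" "exec c s t2 s2" "exec (While b c) s2 v2 s''"
    by (rule WhileE) (use WhileTrue.hyps(1) in blast)+
  from WhileTrue.IH(1)[OF *(2)] have "t2 = t" "s2 = s'" by simp_all
  with WhileTrue.IH(2) * show ?case by simp
qed (auto elim: SkipE AssignE)

text \<open>
  Since runs are unique, it does not matter that the run is quantified existentially. The answer
  is delivered in \<open>out[0]\<close>.
\<close>

definition decides_in_poly_time ::
    "com \<Rightarrow> 'i set \<Rightarrow> ('i \<Rightarrow> store) \<Rightarrow> ('i \<Rightarrow> nat) \<Rightarrow> ('i \<Rightarrow> bool) \<Rightarrow> bool" where
  "decides_in_poly_time c Inst enc sz P \<longleftrightarrow>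
     (\<exists>p :: nat poly. \<forall>x \<in> Inst. \<exists>t s.
        exec c (enc x) t s \<and> t \<le> poly p (sz x) \<and> s ''out'' 0 = (if P x then 1 else 0))"


section \<open>Instances of the decision problem\<close>

text \<open>
  Up to isomorphism, a finite loopless digraph has vertices \<open>0, ..., n - 1\<close> and arcs
  \<open>0, ..., m - 1\<close>, and is presented by its list of arcs. The numbers \<open>k\<close> and \<open>l\<close> are
  measured by their binary length. Every vertex and every arc counts 1; the additional factor
  \<open>O(log n)\<close> for writing down vertex names is polynomially irrelevant.
\<close>

definition instances :: "((nat, nat) pre_digraph \<times> nat \<times> nat) set" where
  "instances = {(D, k, l). fin_digraph D \<and> loopfree_digraph D \<and>
     verts D = {..<card (verts D)} \<and> arcs D = {..<card (arcs D)}}"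

fun instance_store :: "(nat, nat) pre_digraph \<times> nat \<times> nat \<Rightarrow> store" where
  "instance_store (D, k, l) = (\<lambda>_ _. 0)
     (''n'' := (\<lambda>_. 0)(0 := card (verts D)),
      ''m'' := (\<lambda>_. 0)(0 := card (arcs D)),
      ''tail'' := (\<lambda>a. if a \<in> arcs D then tail D a else 0),
      ''head'' := (\<lambda>a. if a \<in> arcs D then head D a else 0),
      ''k'' := (\<lambda>_. 0)(0 := k),
      ''l'' := (\<lambda>_. 0)(0 := l))"

fun instance_size :: "(nat, nat) pre_digraph \<times> nat \<times> nat \<Rightarrow> nat" where
  "instance_size (D, k, l) =
     card (verts D) + card (arcs D) + nat (bitlen (int k)) + nat (bitlen (int l))"

end

theory Submission
  imports Defs
begin

text \<open>
  A digraph on at least three vertices is antistrong iff its bipartite representation, with an edge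
  from the out-copy of \<open>x\<close> to the in-copy of \<open>y\<close> for each arc \<open>xy\<close>, is connected. The question is
  therefore whether the arcs contain disjoint bases of \<open>k\<close> copies of one graphic matroid and \<open>l\<close>
  copies of another.

  Disjoint independent sets of maximum total size are found by a push-relabel method in the style of
  Frank and Miklos, which needs no augmenting paths. Each arc carries a level, and for every colour
  class an arc of level \<open>j \<ge> 2\<close> is spanned by the members of the class on levels at least
  \<open>j - 1\<close>. An uncoloured arc \<open>e\<close> of level \<open>j\<close> replaces a member \<open>t\<close> of level \<open>j - 1\<close> in some class
  if this keeps the class independent; if there is no such \<open>t\<close>, its level is raised. Either step lowers a
  quadratically bounded potential. Once all uncoloured arcs have reached level \<open>m + 1\<close>, one of the
  \<open>m\<close> levels below is empty, and the arcs above that gap show that the packing is maximum.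

  Components are computed by merging labels, one arc at a time. For at least two vertices, more
  subdigraphs than arcs are impossible, so \<open>k\<close> and \<open>l\<close> only enter loops when bounded by \<open>m\<close>; smaller
  digraphs are treated directly.
\<close>


section \<open>Packing bases of matroids by exchanges\<close>

text \<open>Closure operators suit graphs: there, spanning means that the end points of an edge are
  connected, so the axioms become facts about reachability.\<close>

locale closure_matroid =
  fixes cl :: "'e set \<Rightarrow> 'e set"
  assumes extensive: "S \<subseteq> cl S"
    and mono: "S \<subseteq> T \<Longrightarrow> cl S \<subseteq> cl T"
    and idem: "cl (cl S) \<subseteq> cl S"
    and exchange: "y \<in> cl (insert x S) \<Longrightarrow> y \<notin> cl S \<Longrightarrow> x \<in> cl (insert y S)"
begin

definition indep :: "'e set \<Rightarrow> bool" where
  "indep S \<longleftrightarrow> (\<forall>x\<in>S. x \<notin> cl (S - {x}))"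

lemma cl_least: "S \<subseteq> cl T \<Longrightarrow> cl S \<subseteq> cl T"
  using mono[of S "cl T"] idem[of T] by blast

text \<open>If adding \<open>e\<close> made an old element \<open>x\<close> dependent on the others,
  exchange would put \<open>e\<close> into the closure of \<open>S\<close>.\<close>

lemma indep_insert:
  assumes "indep S" "e \<notin> cl S"
  shows "indep (insert e S)"
  unfolding indep_def
proof
  fix x assume x: "x \<in> insert e S"
  show "x \<notin> cl (insert e S - {x})"
  proof (cases "x = e")
    case True
    then show ?thesis using assms(2) mono[of "insert e S - {x}" S] by blast
  next
    case False
    with x have "x \<in> S" by simp
    with assms(1) have "x \<notin> cl (S - {x})" by (simp add: indep_def)
    moreover have "insert e S - {x} = insert e (S - {x})" "insert x (S - {x}) = S"
      using False \<open>x \<in> S\<close> by auto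
    ultimately show ?thesis using exchange[of x e "S - {x}"] assms(2) by auto
  qed
qed

lemma indep_subset:
  assumes "indep S" "T \<subseteq> S"
  shows "indep T"
  unfolding indep_def
proof
  fix x assume "x \<in> T"
  with assms have "x \<notin> cl (S - {x})" by (auto simp: indep_def)
  with mono[of "T - {x}" "S - {x}"] assms(2) show "x \<notin> cl (T - {x})" by blast
qed

text \<open>Drop elements of \<open>S - B\<close> one at a time while \<open>e\<close> stays
  spanned. As \<open>B\<close> does not span \<open>e\<close>, some removal destroys this; exchange
  applies to the element removed there.\<close>

lemma exchange_out:
  assumes "finite S" "B \<subseteq> S" "e \<in> cl S" "e \<notin> cl B"
  shows "\<exists>t \<in> S - B. t \<in> cl (insert e (S - {t}))"
  using assms
proof (induction S rule: finite_psubset_induct)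
  case (psubset S)
  then obtain s where s: "s \<in> S" "s \<notin> B" by (metis subset_antisym subsetI)
  show ?case
  proof (cases "e \<in> cl (S - {s})")
    case True
    have "S - {s} \<subset> S" "B \<subseteq> S - {s}" using s psubset.prems by auto
    from psubset.IH[OF this True psubset.prems(3)]
    obtain t where t: "t \<in> S - {s} - B" "t \<in> cl (insert e (S - {s} - {t}))" by blast
    have "cl (insert e (S - {s} - {t})) \<subseteq> cl (insert e (S - {t}))" by (intro mono) auto
    with t show ?thesis by blast
  next
    case False
    have "insert s (S - {s}) = S" using s by auto
    with False psubset.prems have "s \<in> cl (insert e (S - {s}))"
      using exchange[of e s "S - {s}"] by simp
    with s show ?thesis by blast
  qed
qed

text \<open>Steinitz exchange: an element of \<open>J - I\<close> replaces one of
  \<open>I - J\<close>, keeping the size of \<open>I\<close> and keeping \<open>J\<close> spanned,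
  until \<open>J\<close> is contained in \<open>I\<close>.\<close>

lemma indep_card_le:
  assumes "finite I" "finite J" "indep J" "J \<subseteq> cl I"
  shows "card J \<le> card I"
  using assms(1,4)
proof (induction "card (J - I)" arbitrary: I)
  case 0
  then have "J \<subseteq> I" using assms(2) by auto
  then show ?case using 0 by (simp add: card_mono)
next
  case (Suc d)
  then obtain x where x: "x \<in> J" "x \<notin> I"
    by (metis Diff_iff card.empty equals0I nat.distinct(1))
  \<comment> \<open>Taking \<open>B = I \<inter> J\<close> in \<open>exchange_out\<close> forces the
    discarded element to lie outside \<open>J\<close>, so \<open>J - I\<close> shrinks by exactly
    \<open>x\<close>.\<close>
  have "x \<notin> cl (I \<inter> J)"
    using assms(3) x mono[of "I \<inter> J" "J - {x}"] by (auto simp: indep_def)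
  with exchange_out[of I "I \<inter> J" x] Suc.prems x
  obtain y where y: "y \<in> I" "y \<notin> J" "y \<in> cl (insert x (I - {y}))" by blast
  let ?I = "insert x (I - {y})"
  have "I \<subseteq> cl ?I" using y(3) extensive[of ?I] by blast
  then have "J \<subseteq> cl ?I" using cl_least[of I ?I] Suc.prems(2) by blast
  moreover have "J - I = insert x (J - ?I)" "x \<notin> J - ?I" using x y by auto
  then have "d = card (J - ?I)"
    using Suc.hyps(2) assms(2) by simp
  ultimately have "card J \<le> card ?I" using Suc.hyps(1)[of ?I] Suc.prems(1) by simp
  also have "\<dots> = card I" using x y Suc.prems(1) card_Suc_Diff1[of I y] by simp
  finally show ?case .
qed

lemma obtain_basis:
  assumes "finite S"
  obtains B where "B \<subseteq> S" "indep B" "S \<subseteq> cl B"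
proof -
  have "\<exists>B\<subseteq>S. indep B \<and> S \<subseteq> cl B"
    using assms
  proof induction
    case empty
    then show ?case by (auto simp: indep_def)
  next
    case (insert x S)
    then obtain B where B: "B \<subseteq> S" "indep B" "S \<subseteq> cl B" by blast
    show ?case
    proof (cases "x \<in> cl B")
      case True
      with B show ?thesis by blast
    next
      case False
      have "insert x S \<subseteq> cl (insert x B)"
        using B(3) mono[of B "insert x B"] extensive[of "insert x B"] by blast
      with indep_insert[OF B(2) False] B(1) show ?thesis by blast
    qed
  qed
  with that show ?thesis by blast
qed

end

text \<open>
  Elements are \<open>0, \<dots>, m - 1\<close>; \<open>c f = i < K\<close> puts \<open>f\<close> into class \<open>i\<close> and \<open>c f = K\<close> leaves it
  uncoloured. The index \<open>m + i\<close> is a dummy of class \<open>i\<close> on level 0: exchanging against it means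
  adding an element to class \<open>i\<close>.
\<close>

locale matroid_packing =
  fixes m K :: nat and cl :: "nat \<Rightarrow> nat set \<Rightarrow> nat set"
  assumes matroid: "closure_matroid (cl i)"
begin

sublocale M: closure_matroid "cl i" for i
  by (rule matroid)

definition colour_class :: "(nat \<Rightarrow> nat) \<Rightarrow> nat \<Rightarrow> nat set" where
  "colour_class c i = {f. f < m \<and> c f = i}"

text \<open>Level 1 carries no spanning claim, so the empty packing with all levels 1 is valid.
  Dummies on level 0 make the addition of an element of level 1 an exchange across one level like
  any other.\<close>

definition valid :: "(nat \<Rightarrow> nat) \<Rightarrow> (nat \<Rightarrow> nat) \<Rightarrow> bool" where
  "valid c lv \<longleftrightarrow>
     (\<forall>f<m. c f \<le> K \<and> 1 \<le> lv f \<and> lv f \<le> m + 1) \<and>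
     (\<forall>i<K. c (m + i) = i \<and> lv (m + i) = 0) \<and>
     (\<forall>i<K. M.indep i (colour_class c i)) \<and>
     (\<forall>i<K. \<forall>f<m. 2 \<le> lv f \<longrightarrow> f \<in> cl i {t \<in> colour_class c i. lv f \<le> lv t + 1})"

definition active :: "(nat \<Rightarrow> nat) \<Rightarrow> (nat \<Rightarrow> nat) \<Rightarrow> nat \<Rightarrow> bool" where
  "active c lv e \<longleftrightarrow> c e = K \<and> lv e \<le> m"

text \<open>For a dummy \<open>t\<close> nothing is removed from the class, and the last condition
  says that \<open>e\<close> can be added to it.\<close>

definition exchangeable :: "(nat \<Rightarrow> nat) \<Rightarrow> (nat \<Rightarrow> nat) \<Rightarrow> nat \<Rightarrow> nat \<Rightarrow> bool" where
  "exchangeable c lv e t \<longleftrightarrow>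
     t < m + K \<and> c t < K \<and> lv t + 1 = lv e \<and> e \<notin> cl (c t) (colour_class c (c t) - {t})"

text \<open>An exchange keeps all levels but trades an uncoloured element for one a level lower, or
  for none. A relabelling raises the second sum by 1; the factor 2 on the first sum outweighs
  this.\<close>

definition potential :: "(nat \<Rightarrow> nat) \<Rightarrow> (nat \<Rightarrow> nat) \<Rightarrow> nat" where
  "potential c lv = 2 * (\<Sum>f<m. m + 1 - lv f) + (\<Sum>f \<in> colour_class c K. lv f)"

lemma finite_colour_class [simp]: "finite (colour_class c i)"
  by (simp add: colour_class_def)

text \<open>A dummy must keep its colour to stay available, so only a genuine \<open>t\<close>
  becomes uncoloured.\<close>

definition push :: "(nat \<Rightarrow> nat) \<Rightarrow> nat \<Rightarrow> nat \<Rightarrow> nat \<Rightarrow> nat" where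
  "push c e t = (if t < m then (c(e := c t))(t := K) else c(e := c t))"

section \<open>Exchange steps preserve the invariant\<close>

context
  fixes c lv e t
  assumes valid: "valid c lv" and e: "e < m" and active: "active c lv e"
    and t: "exchangeable c lv e t"
begin

lemma colour_class_push:
  "i < K \<Longrightarrow> colour_class (push c e t) i =
     (if i = c t then insert e (colour_class c i - {t}) else colour_class c i)"
  using e active t by (auto simp: colour_class_def push_def active_def exchangeable_def)

lemma colour_class_push_K:
  "colour_class (push c e t) K =
     (if t < m then insert t (colour_class c K - {e}) else colour_class c K - {e})"
  using e active t by (auto simp: colour_class_def push_def active_def exchangeable_def)

lemma potential_push: "potential (push c e t) lv < potential c lv"
proof -
  have eK: "e \<in> colour_class c K" using e active by (simp add: colour_class_def active_def)
  have tK: "t \<notin> colour_class c K" using t by (simp add: colour_class_def exchangeable_def)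
  have "(\<Sum>f \<in> colour_class c K. lv f) = lv e + (\<Sum>f \<in> colour_class c K - {e}. lv f)"
    using eK by (simp add: sum.remove)
  moreover have "lv t + 1 = lv e" using t by (simp add: exchangeable_def)
  ultimately show ?thesis
    using tK by (auto simp: potential_def colour_class_push_K)
qed

text \<open>A spanning set that loses \<open>t\<close> still spans it after \<open>e\<close> has
  come in: the members of the class on levels at least \<open>lv t\<close> span \<open>e\<close>,
  but not without \<open>t\<close>, so by exchange \<open>e\<close> and the others span
  \<open>t\<close>.\<close>

lemma valid_push: "valid (push c e t) lv"
proof -
  let ?c = "push c e t" and ?i = "c t"
  have i: "?i < K" and lvt: "lv t + 1 = lv e" and ncl: "e \<notin> cl ?i (colour_class c ?i - {t})"
    using t by (auto simp: exchangeable_def)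
  have ind: "M.indep ?i (colour_class c ?i)" using valid i by (simp add: valid_def)
  have "M.indep ?i (insert e (colour_class c ?i - {t}))"
    using M.indep_insert[OF M.indep_subset[OF ind]] ncl by blast
  then have indep: "M.indep i (colour_class ?c i)" if "i < K" for i
    using that valid by (auto simp: colour_class_push valid_def)
  have span: "f \<in> cl i {s \<in> colour_class ?c i. lv f \<le> lv s + 1}"
    if f: "i < K" "f < m" "2 \<le> lv f" for i f
  proof -
    let ?A = "{s \<in> colour_class c i. lv f \<le> lv s + 1}"
    let ?B = "{s \<in> colour_class ?c i. lv f \<le> lv s + 1}"
    have fA: "f \<in> cl i ?A" using valid f by (simp add: valid_def)
    show ?thesis
    proof (cases "i = ?i \<and> t \<in> ?A")
      case False
      then have "?A \<subseteq> ?B" using f(1) by (auto simp: colour_class_push)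
      with fA show ?thesis using M.mono by blast
    next
      case True
      then have i: "i = ?i" and tA: "t \<in> ?A" by auto
      from tA have "t < m" by (simp add: colour_class_def)
      \<comment> \<open>A genuine \<open>t\<close> has level at least 1, so the spanning clause is
        available for \<open>e\<close>.\<close>
      then have "2 \<le> lv e" using lvt valid by (auto simp: valid_def)
      then have "e \<in> cl i {s \<in> colour_class c i. lv e \<le> lv s + 1}" (is "_ \<in> cl i ?L")
        using valid e f(1) by (simp add: valid_def)
      moreover have "insert t (?L - {t}) = ?L"
        using tA lvt by auto
      moreover have "e \<notin> cl i (?L - {t})"
        using ncl M.mono[of "?L - {t}" "colour_class c i - {t}" i] i by blast
      ultimately have "t \<in> cl i (insert e (?L - {t}))" using M.exchange[of e i t "?L - {t}"] by simp
      moreover have "insert e (?L - {t}) \<subseteq> ?B"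
        using tA lvt f(1) i by (auto simp: colour_class_push)
      ultimately have "t \<in> cl i ?B" using M.mono by blast
      moreover have "?A - {t} \<subseteq> ?B"
        using f(1) i by (auto simp: colour_class_push)
      ultimately have "?A \<subseteq> cl i ?B" using M.extensive[of ?B i] by blast
      then show ?thesis using fA M.cl_least by blast
    qed
  qed
  have "\<forall>f<m. ?c f \<le> K \<and> 1 \<le> lv f \<and> lv f \<le> m + 1"
    using valid i by (auto simp: valid_def push_def)
  moreover have "\<forall>i<K. ?c (m + i) = i \<and> lv (m + i) = 0"
    using valid e by (auto simp: valid_def push_def)
  ultimately show ?thesis using indep span unfolding valid_def by blast
qed

end

section \<open>Relabelling steps preserve the invariant\<close>

context
  fixes c lv e
  assumes valid: "valid c lv" and e: "e < m" and active: "active c lv e"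
    and stuck: "\<not> (\<exists>t. exchangeable c lv e t)"
begin

lemma potential_relabel: "potential c (lv(e := lv e + 1)) < potential c lv"
proof -
  let ?lv = "lv(e := lv e + 1)"
  have eK: "e \<in> colour_class c K" using e active by (simp add: colour_class_def active_def)
  have "(\<Sum>f \<in> colour_class c K. lv f) = lv e + (\<Sum>f \<in> colour_class c K - {e}. lv f)"
    "(\<Sum>f \<in> colour_class c K. ?lv f) = ?lv e + (\<Sum>f \<in> colour_class c K - {e}. ?lv f)"
    using eK by (simp_all only: sum.remove finite_colour_class)
  moreover have "(\<Sum>f \<in> colour_class c K - {e}. ?lv f) = (\<Sum>f \<in> colour_class c K - {e}. lv f)"
    by (intro sum.cong) auto
  moreover have "(\<Sum>f<m. m + 1 - lv f) = (m + 1 - lv e) + (\<Sum>f \<in> {..<m} - {e}. m + 1 - lv f)"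
    "(\<Sum>f<m. m + 1 - ?lv f) = (m + 1 - ?lv e) + (\<Sum>f \<in> {..<m} - {e}. m + 1 - ?lv f)"
    using e by (simp_all only: sum.remove finite_lessThan lessThan_iff)
  moreover have "(\<Sum>f \<in> {..<m} - {e}. m + 1 - ?lv f) = (\<Sum>f \<in> {..<m} - {e}. m + 1 - lv f)"
    by (intro sum.cong) auto
  ultimately show ?thesis
    using active Suc_diff_le[of "lv e" m] unfolding potential_def active_def by simp
qed

text \<open>For \<open>f \<noteq> e\<close> nothing changes, as \<open>e\<close> is in no class. If
  members on level \<open>lv e - 1\<close> were indispensable for spanning \<open>e\<close>, one of
  them would be exchangeable; so the members on levels at least \<open>lv e\<close> suffice, as the
  new level of \<open>e\<close> requires.\<close>

lemma valid_relabel: "valid c (lv(e := lv e + 1))"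
proof -
  let ?lv = "lv(e := lv e + 1)"
  have ce: "c e = K" "lv e \<le> m" using active by (auto simp: active_def)
  have "f \<in> cl i {t \<in> colour_class c i. ?lv f \<le> ?lv t + 1}"
    if f: "i < K" "f < m" "2 \<le> ?lv f" for i f
  proof -
    have ne: "t \<noteq> e" if "t \<in> colour_class c i" for t
      using that ce f(1) by (auto simp: colour_class_def)
    show ?thesis
    proof (cases "f = e")
      case False
      then have "f \<in> cl i {t \<in> colour_class c i. lv f \<le> lv t + 1}"
        using f valid by (simp add: valid_def)
      also have "{t \<in> colour_class c i. lv f \<le> lv t + 1} = {t \<in> colour_class c i. ?lv f \<le> ?lv t + 1}"
        using ne False by auto
      finally show ?thesis .
    next
      case True
      have eq: "{t \<in> colour_class c i. ?lv f \<le> ?lv t + 1} = {t \<in> colour_class c i. lv e \<le> lv t}"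
        (is "_ = ?B") using ne True by auto
      have "e \<in> cl i ?B"
      proof (cases "2 \<le> lv e")
        \<comment> \<open>On level 1 the invariant is silent, but failure to exchange with the dummy
          of class \<open>i\<close> says directly that the class spans \<open>e\<close>.\<close>
        case False
        have le: "1 \<le> lv t" if "t < m" for t using valid that by (simp add: valid_def)
        with e have "lv e = 1" using False by fastforce
        moreover have "\<not> exchangeable c lv e (m + i)" using stuck by blast
        ultimately have "e \<in> cl i (colour_class c i - {m + i})"
          using valid f(1) by (auto simp: exchangeable_def valid_def)
        moreover have "colour_class c i - {m + i} = ?B"
          using \<open>lv e = 1\<close> le by (auto simp: colour_class_def)
        ultimately show ?thesis by simp
      next
        case True
        let ?A = "{t \<in> colour_class c i. lv e \<le> lv t + 1}"
        have eA: "e \<in> cl i ?A" using True e f(1) valid by (simp add: valid_def)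
        show ?thesis
        proof (rule ccontr)
          assume "e \<notin> cl i ?B"
          moreover have "finite ?A" "?B \<subseteq> ?A" by auto
          ultimately obtain t where t: "t \<in> ?A - ?B" "t \<in> cl i (insert e (?A - {t}))"
            using M.exchange_out[of ?A ?B e i] eA by blast
          have tl: "lv t + 1 = lv e" "t < m" "c t = i" using t(1) by (auto simp: colour_class_def)
          let ?I = "colour_class c i - {t}"
          \<comment> \<open>As \<open>t\<close> is not exchangeable, the class without
            \<open>t\<close> spans \<open>e\<close>, and therefore also \<open>t\<close>, against
            independence.\<close>
          have "e \<in> cl i ?I"
            using stuck tl f(1) unfolding exchangeable_def by (metis trans_less_add1)
          then have "insert e (?A - {t}) \<subseteq> cl i ?I"
            using M.extensive[of ?I i] by blast
          then have "t \<in> cl i ?I" using t(2) M.cl_least by blast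
          moreover have "M.indep i (colour_class c i)" using valid f(1) by (simp add: valid_def)
          ultimately show False using t(1) by (auto simp: M.indep_def)
        qed
      qed
      then show ?thesis using eq True by simp
    qed
  qed
  moreover have "\<forall>f<m. c f \<le> K \<and> 1 \<le> ?lv f \<and> ?lv f \<le> m + 1"
    using valid ce by (auto simp: valid_def)
  moreover have "\<forall>i<K. c (m + i) = i \<and> ?lv (m + i) = 0"
    using valid e by (auto simp: valid_def)
  moreover have "\<forall>i<K. M.indep i (colour_class c i)" using valid by (simp add: valid_def)
  ultimately show ?thesis unfolding valid_def by blast
qed

end

section \<open>Start and optimality of the packing\<close>

lemma valid_init:
  assumes "\<And>f. f < m \<Longrightarrow> c f = K \<and> lv f = 1"
    and "\<And>i. i < K \<Longrightarrow> c (m + i) = i \<and> lv (m + i) = 0"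
  shows "valid c lv"
proof -
  have "colour_class c i = {}" if "i < K" for i
    using assms(1) that by (auto simp: colour_class_def)
  then show ?thesis using assms by (auto simp: valid_def M.indep_def)
qed

lemma potential_init:
  assumes "\<And>f. f < m \<Longrightarrow> c f = K \<and> lv f = 1"
  shows "potential c lv \<le> 2 * m * m + m"
proof -
  have "(\<Sum>f<m. m + 1 - lv f) = (\<Sum>f<m. m)" using assms by (intro sum.cong) auto
  moreover have "colour_class c K = {..<m}" using assms by (auto simp: colour_class_def)
  moreover have "(\<Sum>f<m. lv f) = (\<Sum>f<m. 1)" using assms by (intro sum.cong) auto
  ultimately show ?thesis by (simp add: potential_def)
qed

text \<open>Uncoloured elements are all on level \<open>m + 1\<close>. Given one such
  \<open>u\<close>, the other \<open>m - 1\<close> elements leave some level \<open>j\<close> among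
  \<open>1, ..., m\<close> empty; \<open>R\<close> consists of the elements above \<open>j\<close>.
  The invariant spans an element of \<open>R\<close> by members on levels at least \<open>j\<close>,
  and these lie above \<open>j\<close> because \<open>j\<close> is empty.\<close>

lemma saturated_set:
  assumes valid: "valid c lv" and inactive: "\<And>e. e < m \<Longrightarrow> \<not> active c lv e"
  obtains R where "R \<subseteq> {..<m}" "colour_class c K \<subseteq> R"
    "\<And>i. i < K \<Longrightarrow> R \<subseteq> cl i (colour_class c i \<inter> R)"
proof (cases "colour_class c K = {}")
  case True
  with that[of "{}"] show ?thesis by simp
next
  case False
  then obtain u where u: "u < m" "c u = K" by (auto simp: colour_class_def)
  have top: "lv f = m + 1" if "f < m" "c f = K" for f
    using valid inactive[OF that(1)] that by (auto simp: active_def valid_def le_Suc_eq)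
  have "card (lv ` ({..<m} - {u})) \<le> card ({..<m} - {u})" by (intro card_image_le) simp
  also have "\<dots> < card {1..m}" using u by simp
  finally have "\<not> {1..m} \<subseteq> lv ` ({..<m} - {u})"
    using card_mono[of "lv ` ({..<m} - {u})" "{1..m}"] by fastforce
  then obtain j where "j \<in> {1..m}" and j: "j \<notin> lv ` ({..<m} - {u})" by blast
  then have j: "1 \<le> j" "j \<le> m" "j \<notin> lv ` ({..<m} - {u})" by simp_all
  then have gap: "lv f \<noteq> j" if "f < m" for f
    using that top[OF u] by (cases "f = u") auto
  let ?R = "{f. f < m \<and> j < lv f}"
  have "f \<in> cl i (colour_class c i \<inter> ?R)" if "i < K" "f \<in> ?R" for i f
  proof -
    have "f \<in> cl i {t \<in> colour_class c i. lv f \<le> lv t + 1}"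
      using valid that j by (auto simp: valid_def)
    moreover have "{t \<in> colour_class c i. lv f \<le> lv t + 1} \<subseteq> colour_class c i \<inter> ?R"
      using that gap by (fastforce simp: colour_class_def)
    ultimately show ?thesis using M.mono by blast
  qed
  moreover have "colour_class c K \<subseteq> ?R" using top j by (auto simp: colour_class_def)
  ultimately show ?thesis using that[of ?R] by auto
qed

text \<open>Compare with bases \<open>B i\<close> of the \<open>J i\<close>, splitting at the
  saturated set \<open>R\<close>. Inside \<open>R\<close> each class spans \<open>R\<close>, so
  \<open>B i\<close> is no larger there; outside \<open>R\<close> every element is coloured, so the
  classes win in total. As no class exceeds its basis, all sizes agree, and an independent set as
  large as a basis spans.\<close>

theorem spanning_if_packing:
  assumes valid: "valid c lv" and inactive: "\<And>e. e < m \<Longrightarrow> \<not> active c lv e"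
    and J: "\<And>i. i < K \<Longrightarrow> J i \<subseteq> {..<m}" "disjoint_family_on J {..<K}"
    and spanning: "\<And>i. i < K \<Longrightarrow> {..<m} \<subseteq> cl i (J i)"
    and i: "i < K"
  shows "{..<m} \<subseteq> cl i (colour_class c i)"
proof -
  let ?I = "colour_class c"
  have "\<forall>i. \<exists>B. i < K \<longrightarrow> B \<subseteq> J i \<and> M.indep i B \<and> J i \<subseteq> cl i B"
  proof
    fix i
    show "\<exists>B. i < K \<longrightarrow> B \<subseteq> J i \<and> M.indep i B \<and> J i \<subseteq> cl i B"
    proof (cases "i < K")
      case True
      show ?thesis
        by (rule M.obtain_basis[OF finite_subset[OF J(1)[OF True] finite_lessThan], of i]) blast
    qed simp
  qed
  from choice[OF this] obtain B
    where B': "\<And>i. i < K \<Longrightarrow> B i \<subseteq> J i \<and> M.indep i (B i) \<and> J i \<subseteq> cl i (B i)" by blast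
  have B: "B i \<subseteq> J i" "M.indep i (B i)" "J i \<subseteq> cl i (B i)" if "i < K" for i
    using B'[OF that] by blast+
  have Bm: "B i \<subseteq> {..<m}" if "i < K" for i using B(1) J(1) that by blast
  have finB: "finite (B i)" if "i < K" for i
    using finite_subset[OF Bm[OF that]] by simp
  have Bspan: "{..<m} \<subseteq> cl i (B i)" if "i < K" for i
    using spanning[OF that] M.cl_least[OF B(3)[OF that]] by blast
  have disjB: "disjoint_family_on B {..<K}"
    using J(2) B(1) unfolding disjoint_family_on_def by (meson disjoint_iff lessThan_iff subsetD)
  have indI: "M.indep i (?I i)" if "i < K" for i using valid that by (simp add: valid_def)
  have leIB: "card (?I i) \<le> card (B i)" if "i < K" for i
  proof (rule M.indep_card_le[OF finB[OF that] finite_colour_class indI[OF that]])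
    show "?I i \<subseteq> cl i (B i)" using Bspan[OF that] by (auto simp: colour_class_def)
  qed
  obtain R where R: "R \<subseteq> {..<m}" "?I K \<subseteq> R" "\<And>i. i < K \<Longrightarrow> R \<subseteq> cl i (?I i \<inter> R)"
    by (rule saturated_set[OF valid inactive]) (assumption | rule that)+
  have disjI: "disjoint_family_on ?I {..<K}"
    by (auto simp: disjoint_family_on_def colour_class_def)
  have "(\<Sum>i<K. card (B i)) = (\<Sum>i<K. card (B i \<inter> R)) + (\<Sum>i<K. card (B i - R))"
    unfolding sum.distrib[symmetric] by (intro sum.cong refl card_Int_Diff) (use finB in simp)
  also have "(\<Sum>i<K. card (B i - R)) = card (\<Union>i<K. B i - R)"
    by (intro card_UN_disjoint[symmetric])
      (use finB disjB in \<open>auto simp: disjoint_family_on_def\<close>)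
  also have "\<dots> \<le> card ({..<m} - R)" using Bm by (intro card_mono) auto
  also have "{..<m} - R = (\<Union>i<K. ?I i - R)"
  proof (intro equalityI subsetI)
    fix f assume f: "f \<in> {..<m} - R"
    then have "c f \<noteq> K" "c f \<le> K" using R(2) valid by (auto simp: colour_class_def valid_def)
    with f show "f \<in> (\<Union>i<K. ?I i - R)" by (auto simp: colour_class_def)
  qed (auto simp: colour_class_def)
  also have "card \<dots> = (\<Sum>i<K. card (?I i - R))"
    by (intro card_UN_disjoint) (use disjI in \<open>auto simp: disjoint_family_on_def\<close>)
  also have "(\<Sum>i<K. card (B i \<inter> R)) \<le> (\<Sum>i<K. card (?I i \<inter> R))"
  proof (intro sum_mono)
    fix i assume "i \<in> {..<K}"
    then have i: "i < K" by simp
    show "card (B i \<inter> R) \<le> card (?I i \<inter> R)"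
      using R(3)[OF i] finB[OF i] M.indep_subset[OF B(2)[OF i]]
      by (intro M.indep_card_le[where i=i]) auto
  qed
  finally have "(\<Sum>i<K. card (B i)) \<le> (\<Sum>i<K. card (?I i \<inter> R)) + (\<Sum>i<K. card (?I i - R))"
    by simp
  also have "\<dots> = (\<Sum>i<K. card (?I i))"
    unfolding sum.distrib[symmetric]
    by (intro sum.cong refl card_Int_Diff[symmetric] finite_colour_class)
  finally have "(\<Sum>i<K. card (B i)) \<le> (\<Sum>i<K. card (?I i))" .
  moreover have "(\<Sum>i<K. card (?I i)) < (\<Sum>i<K. card (B i))" if "card (?I i) < card (B i)"
    using that i leIB by (intro sum_strict_mono_ex1) auto
  ultimately have eq: "card (?I i) = card (B i)" using leIB[OF i] by fastforce
  have "B i \<subseteq> cl i (?I i)"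
  proof
    \<comment> \<open>A basis element outside the closure could be added to the class, making it
      larger than the basis.\<close>
    fix x assume x: "x \<in> B i"
    show "x \<in> cl i (?I i)"
    proof (rule ccontr)
      assume nx: "x \<notin> cl i (?I i)"
      then have "x \<notin> ?I i" using M.extensive by blast
      moreover have "card (insert x (?I i)) \<le> card (B i)"
        using x Bm[OF i] Bspan[OF i] M.indep_insert[OF indI[OF i] nx] finB[OF i]
        by (intro M.indep_card_le[where i=i]) (auto simp: colour_class_def)
      ultimately show False using eq by simp
    qed
  qed
  then show ?thesis using Bspan[OF i] M.cl_least by blast
qed

end


section \<open>Connectivity of edge sets\<close>

text \<open>The equivalence closure on the whole type: isolated nodes are their own classes without
  a vertex set being given.\<close>

definition conn :: "('v \<times> 'v) set \<Rightarrow> ('v \<times> 'v) set" where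
  "conn R = (R \<union> R\<inverse>)\<^sup>*"

lemma conn_refl [simp]: "(u, u) \<in> conn R"
  by (simp add: conn_def)

lemma conn_sym: "(u, v) \<in> conn R \<Longrightarrow> (v, u) \<in> conn R"
  unfolding conn_def by (metis converse_Un converse_converse rtrancl_converseD sup_commute)

lemma conn_trans: "(u, v) \<in> conn R \<Longrightarrow> (v, w) \<in> conn R \<Longrightarrow> (u, w) \<in> conn R"
  unfolding conn_def by (rule rtrancl_trans)

lemma conn_extensive: "R \<subseteq> conn R"
  by (auto simp: conn_def)

lemma conn_least:
  assumes "R \<subseteq> conn T"
  shows "conn R \<subseteq> conn T"
proof -
  have "R\<inverse> \<subseteq> conn T" using assms by (auto intro: conn_sym[OF subsetD])
  then have "R \<union> R\<inverse> \<subseteq> conn T" using assms by simp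
  then have "(R \<union> R\<inverse>)\<^sup>* \<subseteq> (conn T)\<^sup>*" by (rule rtrancl_mono)
  then show ?thesis by (simp add: conn_def)
qed

lemma conn_mono: "R \<subseteq> T \<Longrightarrow> conn R \<subseteq> conn T"
  using conn_least conn_extensive by blast

text \<open>A new edge can only merge the components of its end points. Both the exchange axiom and
  the correctness of merging labels rest on this.\<close>

lemma conn_insert:
  "(u, v) \<in> conn (insert (x, y) R) \<longleftrightarrow>
     (u, v) \<in> conn R \<or> (u, x) \<in> conn R \<and> (y, v) \<in> conn R \<or> (u, y) \<in> conn R \<and> (x, v) \<in> conn R"
    (is "?L \<longleftrightarrow> ?P v")
proof
  assume ?L
  then have "(u, v) \<in> (insert (x, y) R \<union> (insert (x, y) R)\<inverse>)\<^sup>*" by (simp add: conn_def)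
  then show "?P v"
  proof induction
    case (step v w)
    from step(2) consider "(v, w) \<in> conn R" | "v = x" "w = y" | "v = y" "w = x"
      by (auto simp: conn_def)
    then show ?case
    proof cases
      case 1
      then show ?thesis using step.IH conn_trans by metis
    next
      case 2
      then show ?thesis using step.IH conn_refl conn_sym conn_trans by metis
    next
      case 3
      then show ?thesis using step.IH conn_refl conn_sym conn_trans by metis
    qed
  qed simp
next
  let ?T = "insert (x, y) R"
  assume "?P v"
  moreover have "conn R \<subseteq> conn ?T" by (rule conn_mono) auto
  moreover have "(x, y) \<in> conn ?T" using conn_extensive by fast
  ultimately show ?L by (meson conn_sym conn_trans subsetD)
qed

text \<open>The graphic matroid, where \<open>p\<close> gives the end points and may map several
  elements to parallel edges. For exchange, a connection between the ends of \<open>y\<close> that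
  needs \<open>x\<close> can be closed up by \<open>y\<close> to join the ends of
  \<open>x\<close>.\<close>

lemma closure_matroid_conn: "closure_matroid (\<lambda>S. {e. p e \<in> conn (p ` S)})"
proof
  fix S T :: "'a set" and x y
  show "S \<subseteq> {e. p e \<in> conn (p ` S)}" using conn_extensive[of "p ` S"] by auto
  show "{e. p e \<in> conn (p ` S)} \<subseteq> {e. p e \<in> conn (p ` T)}" if "S \<subseteq> T"
    using conn_mono[OF image_mono[OF that]] by blast
  show "{e. p e \<in> conn (p ` {e. p e \<in> conn (p ` S)})} \<subseteq> {e. p e \<in> conn (p ` S)}"
    using conn_least[of "p ` {e. p e \<in> conn (p ` S)}" "p ` S"] by blast
  assume y: "y \<in> {e. p e \<in> conn (p ` insert x S)}" "y \<notin> {e. p e \<in> conn (p ` S)}"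
  obtain x1 x2 y1 y2 where eq: "p x = (x1, x2)" "p y = (y1, y2)" by (meson surj_pair)
  with y show "x \<in> {e. p e \<in> conn (p ` insert y S)}"
    by (simp add: conn_insert) (metis conn_sym)
qed


section \<open>Antistrong digraphs as connected bipartite graphs\<close>

text \<open>A forward antidirected trail that may repeat arcs, which is what a path in the bipartite
  graph yields at first.\<close>

definition forward_alternating_walk ::
    "('a, 'b) pre_digraph \<Rightarrow> 'a \<Rightarrow> 'b step list \<Rightarrow> 'a \<Rightarrow> bool" where
  "forward_alternating_walk D x es y \<longleftrightarrow>
     underlying_walk D x es y \<and> successively (\<lambda>e f. snd e \<noteq> snd f) es \<and>
     es \<noteq> [] \<and> snd (hd es) \<and> snd (last es)"

lemma underlying_walk_append:
  "underlying_walk D x (es @ fs) y \<longleftrightarrow> (\<exists>z. underlying_walk D x es z \<and> underlying_walk D z fs y)"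
  if "wf_digraph D"
proof (induction es arbitrary: x)
  case Nil
  have "z \<in> verts D" if "underlying_walk D z fs y" for z
    using that \<open>wf_digraph D\<close>
    by (cases fs) (auto simp: step_from_def wf_digraph.tail_in_verts wf_digraph.head_in_verts)
  then show ?case by auto
qed auto

text \<open>If a repeated arc is traversed twice in the same direction, the piece from one traversal
  to the next is cut out. If the directions differ, both traversals go as well: the walk is then
  back where it was, and the steps around the cut have opposite directions.\<close>

lemma shorter_alternating_walk:
  assumes D: "wf_digraph D" and walk: "forward_alternating_walk D x es y"
    and repeated: "\<not> distinct (map fst es)"
  shows "\<exists>es'. forward_alternating_walk D x es' y \<and> length es' < length es"
proof -
  obtain as bs cs a where "map fst es = as @ [a] @ bs @ [a] @ cs"
    using not_distinct_decomp[OF repeated] by blast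
  then obtain us e vs f ws where es: "es = us @ e # vs @ f # ws" and ef: "fst e = fst f"
    by (auto simp: map_eq_append_conv map_eq_Cons_conv append_eq_map_conv Cons_eq_map_conv)
  let ?alt = "successively (\<lambda>e f. snd e \<noteq> snd f)"
  have alt: "?alt us" "us = [] \<or> snd (last us) \<noteq> snd e" "?alt ws" "ws = [] \<or> snd f \<noteq> snd (hd ws)"
    using walk unfolding es
    by (auto simp: forward_alternating_walk_def successively_append_iff successively_Cons)
  have ends: "us = [] \<longrightarrow> snd e" "us \<noteq> [] \<longrightarrow> snd (hd us)"
    "ws = [] \<longrightarrow> snd f" "ws \<noteq> [] \<longrightarrow> snd (last ws)"
    using walk unfolding es by (auto simp: forward_alternating_walk_def hd_append)
  have uv: "underlying_walk D x us (step_from D e)" "fst e \<in> arcs D"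
    "underlying_walk D (step_to D e) vs (step_from D f)" "underlying_walk D (step_to D f) ws y"
    using walk unfolding es forward_alternating_walk_def underlying_walk_append[OF D]
      underlying_walk.simps by blast+
  show ?thesis
  proof (cases "snd e = snd f")
    case True
    with ef have "e = f" by (simp add: prod_eq_iff)
    with uv have "underlying_walk D x (us @ e # ws) y" by (auto simp: underlying_walk_append[OF D])
    moreover have "?alt (us @ e # ws)"
      using alt \<open>e = f\<close> by (auto simp: successively_append_iff successively_Cons)
    moreover have "snd (hd (us @ e # ws))" "snd (last (us @ e # ws))"
      using ends True by (auto simp: hd_append)
    ultimately show ?thesis using es
      by (intro exI[of _ "us @ e # ws"]) (simp add: forward_alternating_walk_def)
  next
    case False
    then have "step_to D f = step_from D e" using ef by (auto simp: step_from_def step_to_def)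
    with uv have "underlying_walk D x (us @ ws) y" by (auto simp: underlying_walk_append[OF D])
    moreover have "?alt (us @ ws)" using alt False by (auto simp: successively_append_iff)
    \<comment> \<open>If nothing remained, both traversals would be ends of the walk and hence
      forward.\<close>
    moreover have "us @ ws \<noteq> []" using ends False by auto
    moreover have "snd (hd (us @ ws))" "snd (last (us @ ws))"
      using ends alt False \<open>us @ ws \<noteq> []\<close> by (auto simp: hd_append last_append)
    ultimately show ?thesis using es
      by (intro exI[of _ "us @ ws"]) (simp add: forward_alternating_walk_def)
  qed
qed

lemma alternating_walk_imp_trail:
  assumes "wf_digraph D" "forward_alternating_walk D x es y"
  shows "\<exists>es. forward_antidirected_trail D x es y"
  using assms(2)
proof (induction "length es" arbitrary: es rule: less_induct)
  case less
  show ?case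
  proof (cases "distinct (map fst es)")
    case True
    with less.prems show ?thesis
      by (auto simp: forward_antidirected_trail_def antidirected_trail_def forward_alternating_walk_def)
  next
    case False
    then show ?thesis using shorter_alternating_walk[OF assms(1) less.prems] less.hyps by blast
  qed
qed

text \<open>The node type is left open so that the numbering by \<open>id\<close> and a shift by
  \<open>card (verts D)\<close> becomes an instance; \<open>p\<close> gives the out-copies and
  \<open>q\<close> the in-copies.\<close>

locale bipartite_representation = wf_digraph D for D :: "('a, 'b) pre_digraph" +
  fixes p q :: "'a \<Rightarrow> 'v"
  assumes inj_p: "inj_on p (verts D)" and inj_q: "inj_on q (verts D)"
    and disjoint: "p ` verts D \<inter> q ` verts D = {}"
begin

definition edges :: "('v \<times> 'v) set" where
  "edges = (\<lambda>e. (p (tail D e), q (head D e))) ` arcs D"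

text \<open>A forward step crosses from an out-copy to an in-copy and a backward step crosses back,
  so alternation is exactly what makes consecutive edges meet.\<close>

lemma alternating_walk_conn:
  assumes "underlying_walk D x es y" "successively (\<lambda>e f. snd e \<noteq> snd f) es" "es \<noteq> []"
  shows "(if snd (hd es) then p x else q x, if snd (last es) then q y else p y) \<in> conn edges"
  using assms
proof (induction es arbitrary: x)
  case (Cons e es)
  have "(p (tail D (fst e)), q (head D (fst e))) \<in> conn edges"
    using Cons.prems conn_extensive by (force simp: edges_def)
  then have e: "(if snd e then p x else q x,
      if snd e then q (step_to D e) else p (step_to D e)) \<in> conn edges"
    using Cons.prems by (auto simp: step_from_def step_to_def conn_sym)
  show ?case
  proof (cases "es = []")
    case True
    with e Cons.prems show ?thesis by auto
  next
    case False
    then have "snd (hd es) = (\<not> snd e)" using Cons.prems by (cases es) auto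
    moreover have "(if snd (hd es) then p (step_to D e) else q (step_to D e),
        if snd (last es) then q y else p y) \<in> conn edges"
      using Cons False by (auto simp: successively_Cons)
    ultimately show ?thesis using e False by (auto intro: conn_trans split: if_splits)
  qed
qed simp

text \<open>Each edge of a path switches sides, so the claims for paths ending at in-copies and at
  out-copies are proved together. Only a walk ending at an out-copy can be empty.\<close>

lemma conn_imp_alternating_walk:
  assumes "(p x, b) \<in> conn edges" "x \<in> verts D"
  shows "(\<forall>y\<in>verts D. b = q y \<longrightarrow> (\<exists>es. forward_alternating_walk D x es y)) \<and>
    (\<forall>y\<in>verts D. b = p y \<longrightarrow> (\<exists>es. underlying_walk D x es y \<and>
        successively (\<lambda>e f. snd e \<noteq> snd f) es \<and> (es \<noteq> [] \<longrightarrow> snd (hd es) \<and> \<not> snd (last es))))"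
    (is "?F b \<and> ?B b")
  using assms(1) unfolding conn_def
proof induction
  case base
  have "p x \<noteq> q y" if "y \<in> verts D" for y using disjoint assms(2) that by blast
  moreover have "y = x" if "y \<in> verts D" "p x = p y" for y
    using inj_p assms(2) that by (auto dest: inj_onD)
  ultimately show ?case using assms(2) by (auto intro!: exI[of _ "[]"])
next
  case (step b b')
  from step(2) obtain a where a: "a \<in> arcs D"
    and bb': "(b = p (tail D a) \<and> b' = q (head D a)) \<or> (b = q (head D a) \<and> b' = p (tail D a))"
    by (auto simp: edges_def)
  from bb' show ?case
  proof
    assume b: "b = p (tail D a) \<and> b' = q (head D a)"
    with step.IH tail_in_verts[OF a] obtain es where es: "underlying_walk D x es (tail D a)"
      "successively (\<lambda>e f. snd e \<noteq> snd f) es" "es \<noteq> [] \<longrightarrow> snd (hd es) \<and> \<not> snd (last es)"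
      by blast
    have "forward_alternating_walk D x (es @ [(a, True)]) (head D a)"
      using es a by (auto simp: forward_alternating_walk_def underlying_walk_append[OF wf_digraph]
          successively_append_iff step_from_def step_to_def hd_append)
    moreover have "y = head D a" if "y \<in> verts D" "b' = q y" for y
      using inj_q b a that by (auto dest: inj_onD)
    moreover have "b' \<noteq> p y" if "y \<in> verts D" for y
      using disjoint b a that by (metis disjoint_iff head_in_verts imageI)
    ultimately show ?thesis by blast
  next
    assume b: "b = q (head D a) \<and> b' = p (tail D a)"
    with step.IH head_in_verts[OF a] obtain es where es: "forward_alternating_walk D x es (head D a)"
      by blast
    then have "underlying_walk D x (es @ [(a, False)]) (tail D a) \<and>
        successively (\<lambda>e f. snd e \<noteq> snd f) (es @ [(a, False)]) \<and>
        (snd (hd (es @ [(a, False)])) \<and> \<not> snd (last (es @ [(a, False)])))"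
      using a by (auto simp: forward_alternating_walk_def underlying_walk_append[OF wf_digraph]
          successively_append_iff step_from_def step_to_def hd_append)
    moreover have "y = tail D a" if "y \<in> verts D" "b' = p y" for y
      using inj_p b a that by (auto dest: inj_onD)
    moreover have "b' \<noteq> q y" if "y \<in> verts D" for y
      using disjoint b a that by (metis disjoint_iff tail_in_verts imageI)
    ultimately show ?thesis by blast
  qed
qed

lemma antistrong_iff_conn:
  assumes card: "3 \<le> card (verts D)"
  shows "antistrong D \<longleftrightarrow> (\<forall>x\<in>verts D. \<forall>y\<in>verts D. (p x, q y) \<in> conn edges)"
proof
  assume anti: "antistrong D"
  have ne: "(p x, q y) \<in> conn edges" if xy: "x \<in> verts D" "y \<in> verts D" "x \<noteq> y" for x y
  proof -
    obtain es where "forward_antidirected_trail D x es y"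
      using anti xy unfolding antistrong_def by blast
    then show ?thesis using alternating_walk_conn[of x es y]
      by (simp add: forward_antidirected_trail_def antidirected_trail_def)
  qed
  show "\<forall>x\<in>verts D. \<forall>y\<in>verts D. (p x, q y) \<in> conn edges"
  proof (intro ballI)
    fix x y assume xy: "x \<in> verts D" "y \<in> verts D"
    show "(p x, q y) \<in> conn edges"
    proof (cases "x = y")
      case True
      \<comment> \<open>Trails are only given between distinct vertices. Two further vertices
        \<open>z\<close> and \<open>w\<close> supply trails from \<open>x\<close> to
        \<open>z\<close>, from \<open>w\<close> to \<open>z\<close> and from \<open>w\<close> to
        \<open>x\<close>, which connect the two copies of \<open>x\<close>.\<close>
      have fin: "finite (verts D)" using card card.infinite by fastforce
      have "\<not> verts D \<subseteq> {x}" using card card_mono[of "{x}" "verts D"] by auto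
      then obtain z where z: "z \<in> verts D" "z \<noteq> x" by blast
      have "\<not> verts D \<subseteq> {x, z}" using card card_mono[of "{x, z}" "verts D"] z by auto
      then obtain w where w: "w \<in> verts D" "w \<noteq> x" "w \<noteq> z" by blast
      have "(p x, q z) \<in> conn edges" "(q z, p w) \<in> conn edges" "(p w, q x) \<in> conn edges"
        using ne xy z w by (auto intro: conn_sym)
      then show ?thesis using True by (blast intro: conn_trans)
    qed (use ne xy in blast)
  qed
next
  assume "\<forall>x\<in>verts D. \<forall>y\<in>verts D. (p x, q y) \<in> conn edges"
  then show "antistrong D"
    unfolding antistrong_def
    using card conn_imp_alternating_walk alternating_walk_imp_trail[OF wf_digraph] by blast
qed

end

lemma (in wf_digraph) connected_iff_conn:
  "Digraph_Component.connected G \<longleftrightarrow>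
     verts G \<noteq> {} \<and> (\<forall>u\<in>verts G. \<forall>v\<in>verts G. (u, v) \<in> conn ((\<lambda>e. (tail G e, head G e)) ` arcs G))"
proof -
  let ?E = "(\<lambda>e. (tail G e, head G e)) ` arcs G"
  interpret S: pair_wf_digraph "mk_symmetric G" ..
  have "parcs (mk_symmetric G) = ?E \<union> ?E\<inverse>" by (auto simp: parcs_mk_symmetric)
  then have "(u \<rightarrow>\<^sup>*\<^bsub>mk_symmetric G\<^esub> v) \<longleftrightarrow> (u, v) \<in> conn ?E"
    if "u \<in> verts G" "v \<in> verts G" for u v
    using that S.reachable_conv by (auto simp: conn_def)
  then show ?thesis by (auto simp: connected_def strongly_connected_def)
qed


section \<open>Bipartite and underlying graphs on numbered nodes\<close>

definition ends :: "(nat, nat) pre_digraph \<Rightarrow> nat \<Rightarrow> nat \<Rightarrow> nat \<Rightarrow> nat \<times> nat" where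
  "ends D k i f = (tail D f, if i < k then head D f + card (verts D) else head D f)"

text \<open>For \<open>i < k\<close> the in-copy of \<open>v\<close> has number
  \<open>v + card (verts D)\<close>, so there are twice as many nodes.\<close>

definition num_nodes :: "(nat, nat) pre_digraph \<Rightarrow> nat \<Rightarrow> nat \<Rightarrow> nat" where
  "num_nodes D k i = (if i < k then card (verts D) + card (verts D) else card (verts D))"

text \<open>Connectivity is tested from node 0 only, which is what the program does by comparing
  labels.\<close>

definition spans :: "(nat, nat) pre_digraph \<Rightarrow> nat \<Rightarrow> nat \<Rightarrow> nat set \<Rightarrow> bool" where
  "spans D k i S \<longleftrightarrow> (\<forall>v < num_nodes D k i. (0, v) \<in> conn (ends D k i ` S))"

lemma spans_antistrong_iff:
  assumes "wf_digraph D" "verts D = {..<card (verts D)}" "3 \<le> card (verts D)" "i < k"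
  shows "spans D k i (arcs D) \<longleftrightarrow> antistrong D"
proof -
  let ?n = "card (verts D)"
  interpret bipartite_representation D id "\<lambda>v. v + ?n"
    using assms(1,2)
    by (auto simp: bipartite_representation_def bipartite_representation_axioms_def)
  have mem: "x \<in> verts D \<longleftrightarrow> x < ?n" for x using assms(2) by blast
  have E: "ends D k i ` arcs D = edges"
    using assms(4) by (auto simp: ends_def edges_def)
  have "antistrong D \<longleftrightarrow> (\<forall>x\<in>verts D. \<forall>y\<in>verts D. (id x, y + ?n) \<in> conn edges)"
    using antistrong_iff_conn[OF assms(3)] .
  also have "\<dots> \<longleftrightarrow> (\<forall>x<?n. \<forall>y<?n. (x, y + ?n) \<in> conn edges)"
    unfolding Ball_def mem by simp
  also have "\<dots> \<longleftrightarrow> (\<forall>v < ?n + ?n. (0, v) \<in> conn edges)"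
  proof safe
    fix v assume *: "\<forall>x<?n. \<forall>y<?n. (x, y + ?n) \<in> conn edges" "v < ?n + ?n"
    have n: "0 < ?n" using assms(3) by simp
    show "(0, v) \<in> conn edges"
    proof (cases "v < ?n")
      case True
      \<comment> \<open>Two out-copies are connected through a common in-copy.\<close>
      then show ?thesis using * n by (meson conn_sym conn_trans)
    next
      case False
      then have "v = (v - ?n) + ?n" "v - ?n < ?n" using *(2) by auto
      then show ?thesis using *(1) n by metis
    qed
  next
    fix x y assume *: "\<forall>v<?n + ?n. (0, v) \<in> conn edges" "x < ?n" "y < ?n"
    then have "(0, x) \<in> conn edges" "(0, y + ?n) \<in> conn edges" by auto
    then show "(x, y + ?n) \<in> conn edges" by (meson conn_sym conn_trans)
  qed
  finally show ?thesis using assms(4) by (simp add: spans_def num_nodes_def E)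
qed

lemma spans_connected_iff:
  assumes "wf_digraph D" "verts D = {..<card (verts D)}" "0 < card (verts D)" "\<not> i < k"
  shows "spans D k i (arcs D) \<longleftrightarrow> Digraph_Component.connected D"
proof -
  have mem: "x \<in> verts D \<longleftrightarrow> x < card (verts D)" for x using assms(2) by blast
  have E: "ends D k i ` arcs D = (\<lambda>e. (tail D e, head D e)) ` arcs D" (is "_ = ?E")
    using assms(4) by (auto simp: ends_def)
  have "Digraph_Component.connected D \<longleftrightarrow> (\<forall>u\<in>verts D. \<forall>v\<in>verts D. (u, v) \<in> conn ?E)"
    using wf_digraph.connected_iff_conn[OF assms(1)] assms(3) by auto
  also have "\<dots> \<longleftrightarrow> (\<forall>v < card (verts D). (0, v) \<in> conn ?E)"
    unfolding Ball_def mem using assms(3) by (meson conn_sym conn_trans)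
  finally show ?thesis using assms(4) by (simp add: spans_def num_nodes_def E)
qed

lemma spans_nonempty:
  assumes "spans D k i S" "2 \<le> card (verts D)"
  shows "S \<noteq> {}"
proof
  assume "S = {}"
  moreover have "1 < num_nodes D k i" using assms(2) by (simp add: num_nodes_def)
  ultimately show False using assms(1) by (auto simp: spans_def conn_def)
qed

text \<open>With \<open>conn_if_spans\<close> this translates between connecting all nodes and
  spanning all arcs in the matroid.\<close>

lemma spans_mono_conn:
  assumes "spans D k i S" "ends D k i ` S \<subseteq> conn (ends D k i ` T)"
  shows "spans D k i T"
  using assms conn_least unfolding spans_def by blast

lemma conn_if_spans:
  assumes "spans D k i S" "wf_digraph D" "verts D = {..<card (verts D)}" "f \<in> arcs D"
  shows "ends D k i f \<in> conn (ends D k i ` S)"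
proof -
  have "tail D f < card (verts D)" "head D f < card (verts D)"
    using assms(2,3,4) wf_digraph.tail_in_verts wf_digraph.head_in_verts by (metis lessThan_iff)+
  then have "fst (ends D k i f) < num_nodes D k i" "snd (ends D k i f) < num_nodes D k i"
    by (auto simp: ends_def num_nodes_def)
  then have "(fst (ends D k i f), snd (ends D k i f)) \<in> conn (ends D k i ` S)"
    using assms(1) unfolding spans_def by (meson conn_sym conn_trans)
  then show ?thesis by simp
qed

text \<open>A spanning subdigraph is determined by its arcs, and \<open>spans\<close> depends on a
  digraph only through vertices, tails and heads.\<close>

lemma has_arc_disjoint_subdigraphs_iff:
  assumes D: "wf_digraph D" "verts D = {..<card (verts D)}" "2 \<le> card (verts D)"
    and k: "k = 0 \<or> 3 \<le> card (verts D)"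
  shows "has_arc_disjoint_subdigraphs D k l \<longleftrightarrow>
    (\<exists>J. (\<forall>i < k + l. J i \<subseteq> arcs D \<and> spans D k i (J i)) \<and> disjoint_family_on J {..<k + l})"
proof
  assume "has_arc_disjoint_subdigraphs D k l"
  then obtain H where H: "\<forall>i < k + l. spanning (H i) D"
    "disjoint_family_on (\<lambda>i. arcs (H i)) {..<k + l}"
    "\<forall>i < k. antistrong (H i)" "\<forall>i \<in> {k..<k + l}. Digraph_Component.connected (H i)"
    unfolding has_arc_disjoint_subdigraphs_def by blast
  have "arcs (H i) \<subseteq> arcs D \<and> spans D k i (arcs (H i))" if i: "i < k + l" for i
  proof -
    have sub: "wf_digraph (H i)" "verts (H i) = verts D" "arcs (H i) \<subseteq> arcs D"
      "tail (H i) = tail D" "head (H i) = head D"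
      using H(1) i by (auto simp: spanning_def subgraph_def compatible_def)
    then have eq: "spans (H i) k i = spans D k i"
      by (auto simp: fun_eq_iff spans_def num_nodes_def ends_def[abs_def])
    have "spans (H i) k i (arcs (H i))"
    proof (cases "i < k")
      case True
      then show ?thesis using spans_antistrong_iff[of "H i" i k] sub D k H(3) by auto
    next
      case False
      then show ?thesis using spans_connected_iff[of "H i" i k] sub D H(4) i by auto
    qed
    then show ?thesis using eq sub by simp
  qed
  with H(2) show "\<exists>J. (\<forall>i < k + l. J i \<subseteq> arcs D \<and> spans D k i (J i)) \<and> disjoint_family_on J {..<k + l}"
    by (intro exI[of _ "\<lambda>i. arcs (H i)"]) blast
next
  assume "\<exists>J. (\<forall>i < k + l. J i \<subseteq> arcs D \<and> spans D k i (J i)) \<and> disjoint_family_on J {..<k + l}"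
  then obtain J where J: "\<And>i. i < k + l \<Longrightarrow> J i \<subseteq> arcs D" "\<And>i. i < k + l \<Longrightarrow> spans D k i (J i)"
    "disjoint_family_on J {..<k + l}" by blast
  define H where "H i = D\<lparr>arcs := J i\<rparr>" for i
  have sel: "verts (H i) = verts D" "arcs (H i) = J i" "tail (H i) = tail D" "head (H i) = head D" for i
    by (simp_all add: H_def)
  have wf: "wf_digraph (H i)" if "i < k + l" for i
    using D(1) J(1)[OF that] by (auto simp: wf_digraph_def sel)
  have eq: "spans (H i) k i = spans D k i" for i
    by (auto simp: fun_eq_iff spans_def num_nodes_def ends_def[abs_def] sel)
  have "spanning (H i) D" if "i < k + l" for i
    using wf[OF that] D(1) J(1)[OF that] by (auto simp: spanning_def subgraph_def compatible_def sel)
  moreover have "antistrong (H i)" if "i < k" for i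
    using spans_antistrong_iff[of "H i" i k] wf[of i] that D k J(2)[of i] eq by (auto simp: sel)
  moreover have "Digraph_Component.connected (H i)" if "i \<in> {k..<k + l}" for i
    using spans_connected_iff[of "H i" i k] wf[of i] that D J(2)[of i] eq by (auto simp: sel)
  ultimately show "has_arc_disjoint_subdigraphs D k l"
    unfolding has_arc_disjoint_subdigraphs_def using J(3) by (intro exI[of _ H]) (auto simp: sel)
qed

text \<open>Each of the disjoint sets contains an arc. This allows large \<open>k\<close> and
  \<open>l\<close>, given in binary, to be rejected before any loop of length
  \<open>K\<close>.\<close>

lemma card_le_if_spans:
  assumes J: "\<forall>i < K. J i \<subseteq> arcs D \<and> spans D k i (J i)" "disjoint_family_on J {..<K}"
    and D: "2 \<le> card (verts D)" "finite (arcs D)"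
  shows "K \<le> card (arcs D)"
proof -
  have fin: "finite (J i)" if "i < K" for i using J(1) D(2) that finite_subset[of "J i"] by blast
  have "1 \<le> card (J i)" if "i < K" for i
    using fin[OF that] spans_nonempty[of D k i "J i"] J(1) D(1) that by (simp add: Suc_le_eq card_gt_0_iff)
  then have "(\<Sum>i<K. 1) \<le> (\<Sum>i<K. card (J i))" by (intro sum_mono) auto
  also have "\<dots> = card (\<Union>i<K. J i)"
    using fin J(2) by (intro card_UN_disjoint[symmetric]) (auto simp: disjoint_family_on_def)
  also have "\<dots> \<le> card (arcs D)" using J(1) D(2) by (intro card_mono) auto
  finally show ?thesis by simp
qed

text \<open>Connectedness here demands a vertex, so the empty digraph admits no subdigraph of either
  kind. On one vertex the arcless subdigraph is connected and can be used any number of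
  times.\<close>

lemma has_arc_disjoint_subdigraphs_few_verts:
  assumes "wf_digraph D" "finite (verts D)"
  shows "card (verts D) = 0 \<Longrightarrow> has_arc_disjoint_subdigraphs D k l \<longleftrightarrow> k + l = 0"
    and "card (verts D) < 3 \<Longrightarrow> 0 < k \<Longrightarrow> \<not> has_arc_disjoint_subdigraphs D k l"
    and "card (verts D) = 1 \<Longrightarrow> k = 0 \<Longrightarrow> has_arc_disjoint_subdigraphs D k l"
proof -
  have verts: "verts (H i) = verts D" if "\<forall>i < k + l. spanning (H i) D" "i < k + l" for H :: "nat \<Rightarrow> _" and i
    using that by (auto simp: spanning_def)
  show "\<not> has_arc_disjoint_subdigraphs D k l" if "card (verts D) < 3" "0 < k"
  proof
    assume "has_arc_disjoint_subdigraphs D k l"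
    then obtain H where H: "\<forall>i < k + l. spanning (H i) D" "\<forall>i < k. antistrong (H i)"
      unfolding has_arc_disjoint_subdigraphs_def by blast
    with \<open>0 < k\<close> verts[OF H(1), of 0] that show False by (auto simp: antistrong_def)
  qed
  show "has_arc_disjoint_subdigraphs D k l \<longleftrightarrow> k + l = 0" if card: "card (verts D) = 0"
  proof
    assume has: "has_arc_disjoint_subdigraphs D k l"
    then obtain H where H: "\<forall>i < k + l. spanning (H i) D" "\<forall>i < k. antistrong (H i)"
      "\<forall>i \<in> {k..<k + l}. Digraph_Component.connected (H i)"
      unfolding has_arc_disjoint_subdigraphs_def by blast
    show "k + l = 0"
    proof (rule ccontr)
      assume "k + l \<noteq> 0"
      then have 0: "0 < k + l" by simp
      then have "verts (H 0) = {}" using verts[OF H(1)] card assms(2) by simp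
      moreover have "antistrong (H 0) \<or> Digraph_Component.connected (H 0)"
        using H(2,3) 0 by (cases "k = 0") auto
      ultimately show False
        by (auto simp: antistrong_def connected_def strongly_connected_def)
    qed
  qed (auto simp: has_arc_disjoint_subdigraphs_def disjoint_family_on_def)
  show "has_arc_disjoint_subdigraphs D k l" if card: "card (verts D) = 1" "k = 0"
  proof -
    define H where "H = D\<lparr>arcs := {}\<rparr>"
    have wf: "wf_digraph H" by (simp add: wf_digraph_def H_def)
    obtain v where v: "verts D = {v}" using card(1) card_1_singletonE by blast
    have "Digraph_Component.connected H"
      unfolding wf_digraph.connected_iff_conn[OF wf] using v by (simp add: H_def)
    moreover have "spanning H D"
      using assms(1) wf by (auto simp: spanning_def subgraph_def compatible_def H_def)
    ultimately show ?thesis unfolding has_arc_disjoint_subdigraphs_def using card(2)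
      by (intro exI[of _ "\<lambda>_. H"]) (auto simp: H_def disjoint_family_on_def)
  qed
qed


section \<open>Total correctness with polynomial time bounds\<close>

text \<open>
  A bound on the running time that is correct as long as each loop is iterated at most \<open>Z\<close> times
  whenever it is entered.
\<close>

fun time_bound :: "nat \<Rightarrow> com \<Rightarrow> nat" where
  "time_bound Z SKIP = 1"
| "time_bound Z (Assign x i a) = acost i + acost a + 1"
| "time_bound Z (Seq c d) = time_bound Z c + time_bound Z d"
| "time_bound Z (Cond b c d) = bcost b + 1 + (time_bound Z c + time_bound Z d)"
| "time_bound Z (While b c) = Z * (bcost b + 1 + time_bound Z c) + (bcost b + 1)"

text \<open>For a fixed program the nesting depth of its loops bounds the degree.\<close>

lemma time_bound_poly: "\<exists>p :: nat poly. \<forall>Z. time_bound Z c = poly p Z"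
proof (induction c)
  case SKIP
  show ?case by (intro exI[of _ "[:1:]"]) simp
next
  case (Assign x i a)
  show ?case by (intro exI[of _ "[:acost i + acost a + 1:]"]) simp
next
  case (Seq c d)
  then obtain p q where "\<forall>Z. time_bound Z c = poly p Z" "\<forall>Z. time_bound Z d = poly q Z" by blast
  then show ?case by (intro exI[of _ "p + q"]) simp
next
  case (Cond b c d)
  then obtain p q where "\<forall>Z. time_bound Z c = poly p Z" "\<forall>Z. time_bound Z d = poly q Z" by blast
  then show ?case by (intro exI[of _ "[:bcost b + 1:] + (p + q)"]) simp
next
  case (While b c)
  then obtain p where "\<forall>Z. time_bound Z c = poly p Z" by blast
  then show ?case by (intro exI[of _ "[:0, 1:] * ([:bcost b + 1:] + p) + [:bcost b + 1:]"]) simp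
qed

text \<open>Total correctness with the time bound built in, so that postconditions never mention
  time.\<close>

definition wp :: "nat \<Rightarrow> com \<Rightarrow> (store \<Rightarrow> bool) \<Rightarrow> store \<Rightarrow> bool" where
  "wp Z c Q s \<longleftrightarrow> (\<exists>t s'. exec c s t s' \<and> t \<le> time_bound Z c \<and> Q s')"

lemma wp_mono: "wp Z c P s \<Longrightarrow> (\<And>s'. P s' \<Longrightarrow> Q s') \<Longrightarrow> wp Z c Q s"
  unfolding wp_def by blast

lemma wp_SKIP: "Q s \<Longrightarrow> wp Z SKIP Q s"
  unfolding wp_def using exec.Skip by fastforce

lemma wp_Assign: "Q (s(x := (s x)(aval i s := aval a s))) \<Longrightarrow> wp Z (Assign x i a) Q s"
  unfolding wp_def using exec.Assign by fastforce

lemma wp_Seq: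
  assumes "wp Z c (wp Z d Q) s"
  shows "wp Z (Seq c d) Q s"
proof -
  obtain t s' u s'' where "exec c s t s'" "t \<le> time_bound Z c" "exec d s' u s''"
    "u \<le> time_bound Z d" "Q s''"
    using assms unfolding wp_def by blast
  then show ?thesis unfolding wp_def using exec.Seq[of c s t s' d u s'']
    by (intro exI[of _ "t + u"] exI[of _ s'']) simp
qed

lemma wp_Cond:
  assumes "bval b s \<Longrightarrow> wp Z c Q s" "\<not> bval b s \<Longrightarrow> wp Z d Q s"
  shows "wp Z (Cond b c d) Q s"
proof (cases "bval b s")
  case True
  with assms(1) obtain t s' where "exec c s t s'" "t \<le> time_bound Z c" "Q s'"
    unfolding wp_def by blast
  with exec.CondTrue[OF True, of c t s' d] show ?thesis unfolding wp_def
    by (intro exI[of _ "bcost b + 1 + t"] exI[of _ s']) simp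
next
  case False
  with assms(2) obtain t s' where "exec d s t s'" "t \<le> time_bound Z d" "Q s'"
    unfolding wp_def by blast
  with exec.CondFalse[OF False, of d t s' c] show ?thesis unfolding wp_def
    by (intro exI[of _ "bcost b + 1 + t"] exI[of _ s']) simp
qed

text \<open>The variant serves twice: its decrease gives termination, and its initial value bounds
  the number of iterations.\<close>

lemma wp_While:
  fixes f :: "store \<Rightarrow> nat"
  assumes init: "I s" "f s \<le> Z"
    and body: "\<And>s. I s \<Longrightarrow> bval b s \<Longrightarrow> wp Z c (\<lambda>s'. I s' \<and> f s' < f s) s"
    and post: "\<And>s. I s \<Longrightarrow> \<not> bval b s \<Longrightarrow> Q s"
  shows "wp Z (While b c) Q s"
proof -
  let ?B = "bcost b + 1 + time_bound Z c"
  have "\<exists>t s'. exec (While b c) s t s' \<and> t \<le> f s * ?B + (bcost b + 1) \<and> Q s'"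
    using init(1)
  proof (induction "f s" arbitrary: s rule: less_induct)
    case less
    show ?case
    proof (cases "bval b s")
      case True
      obtain t s' where s': "exec c s t s'" "t \<le> time_bound Z c" "I s'" "f s' < f s"
        using body[OF less.prems True] unfolding wp_def by blast
      obtain u s'' where s'': "exec (While b c) s' u s''" "u \<le> f s' * ?B + (bcost b + 1)" "Q s''"
        using less.hyps[OF s'(4,3)] by blast
      have "Suc (f s') * ?B \<le> f s * ?B" using s'(4) by (intro mult_right_mono) auto
      then have "bcost b + 1 + t + u \<le> f s * ?B + (bcost b + 1)" using s'(2) s''(2) by simp
      with exec.WhileTrue[OF True s'(1) s''(1)] s''(3) show ?thesis by blast
    next
      case False
      have "bcost b + 1 \<le> f s * ?B + (bcost b + 1)" by simp
      with exec.WhileFalse[OF False, of c] post[OF less.prems False] show ?thesis by blast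
    qed
  qed
  then obtain t s' where "exec (While b c) s t s'" "t \<le> f s * ?B + (bcost b + 1)" "Q s'" by blast
  moreover have "f s * ?B \<le> Z * ?B" using init(2) by (rule mult_right_mono) simp
  ultimately show ?thesis unfolding wp_def by (intro exI[of _ t] exI[of _ s']) simp
qed

section \<open>Frame conditions and counting loops\<close>

fun writes :: "com \<Rightarrow> vname set" where
  "writes SKIP = {}"
| "writes (Assign x i a) = {x}"
| "writes (Seq c d) = writes c \<union> writes d"
| "writes (Cond b c d) = writes c \<union> writes d"
| "writes (While b c) = writes c"

definition agree_off :: "vname set \<Rightarrow> store \<Rightarrow> store \<Rightarrow> bool" where
  "agree_off X s s' \<longleftrightarrow> (\<forall>x. x \<notin> X \<longrightarrow> s' x = s x)"

lemma exec_agree: "exec c s t s' \<Longrightarrow> agree_off (writes c) s s'"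
  by (induction rule: exec.induct) (auto simp: agree_off_def)

lemma wp_frame: "wp Z c Q s \<Longrightarrow> wp Z c (\<lambda>s'. Q s' \<and> agree_off (writes c) s s') s"
  unfolding wp_def using exec_agree by blast

abbreviation Var :: "vname \<Rightarrow> aexp" where
  "Var x \<equiv> Sel x (N 0)"

abbreviation Set :: "vname \<Rightarrow> aexp \<Rightarrow> com" where
  "Set x a \<equiv> Assign x (N 0) a"

definition Eq :: "aexp \<Rightarrow> aexp \<Rightarrow> bexp" where
  "Eq a b = Conj (Neg (Less a b)) (Neg (Less b a))"

lemma bval_Eq [simp]: "bval (Eq a b) s \<longleftrightarrow> aval a s = aval b s"
  by (auto simp: Eq_def)

definition For :: "vname \<Rightarrow> aexp \<Rightarrow> com \<Rightarrow> com" where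
  "For x a c = Seq (Set x (N 0)) (While (Less (Var x) a) (Seq c (Set x (Plus (Var x) (N 1)))))"

lemma writes_For [simp]: "writes (For x a c) = insert x (writes c)"
  by (auto simp: For_def)

text \<open>The limit is evaluated afresh in every round, so it must be constant on all stores the
  loop can reach. The invariant sees the counter only as \<open>j\<close>, hence survives its
  increment.\<close>

lemma wp_For:
  assumes "I 0 s"
    and counter: "x \<notin> writes c" "\<And>j s v. I j (s(x := v)) = I j s"
    and limit: "\<And>s'. agree_off (insert x (writes c)) s s' \<Longrightarrow> aval a s' = M" "M \<le> Z"
    and body: "\<And>j s'. j < M \<Longrightarrow> I j s' \<Longrightarrow> s' x 0 = j \<Longrightarrow> agree_off (insert x (writes c)) s s' \<Longrightarrow>
      wp Z c (I (Suc j)) s'"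
    and post: "\<And>s'. I M s' \<Longrightarrow> agree_off (insert x (writes c)) s s' \<Longrightarrow> Q s'"
  shows "wp Z (For x a c) Q s"
  unfolding For_def
proof (rule wp_Seq, rule wp_Assign)
  let ?W = "insert x (writes c)"
  let ?s = "s(x := (s x)(aval (N 0) s := aval (N 0) s))"
  let ?I = "\<lambda>s'. I (s' x 0) s' \<and> s' x 0 \<le> M \<and> agree_off ?W s s'"
  show "wp Z (While (Less (Var x) a) (Seq c (Set x (Plus (Var x) (N 1))))) Q ?s"
  proof (rule wp_While[where I = ?I and f = "\<lambda>s'. M - s' x 0"])
    show "?I ?s" using assms(1) counter(2) by (simp add: agree_off_def)
    show "M - ?s x 0 \<le> Z" using limit(2) by simp
  next
    fix s1 assume I: "?I s1" and b: "bval (Less (Var x) a) s1"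
    have lt: "s1 x 0 < M" using b limit(1)[of s1] I by simp
    have "wp Z c (\<lambda>s2. I (Suc (s1 x 0)) s2 \<and> agree_off (writes c) s1 s2) s1"
      using I lt by (intro wp_frame body) auto
    then show "wp Z (Seq c (Set x (Plus (Var x) (N 1)))) (\<lambda>s2. ?I s2 \<and> M - s2 x 0 < M - s1 x 0) s1"
    proof (intro wp_Seq, elim wp_mono, intro wp_Assign)
      fix s2 assume "I (Suc (s1 x 0)) s2 \<and> agree_off (writes c) s1 s2"
      moreover from this have "s2 x = s1 x" using counter(1) by (auto simp: agree_off_def)
      ultimately show "?I (s2(x := (s2 x)(aval (N 0) s2 := aval (Plus (Var x) (N 1)) s2))) \<and>
          M - (s2(x := (s2 x)(aval (N 0) s2 := aval (Plus (Var x) (N 1)) s2))) x 0 < M - s1 x 0"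
        using lt I counter(2) by (auto simp: agree_off_def)
    qed
  next
    fix s1 assume I: "?I s1" and b: "\<not> bval (Less (Var x) a) s1"
    then have "s1 x 0 = M" using limit(1)[of s1] by simp
    with I show "Q s1" using post[of s1] by simp
  qed
qed


section \<open>The program\<close>

definition LOAD :: "vname \<Rightarrow> com" where
  "LOAD g = Seq (Set ''x'' (Sel ''lab'' (Sel ''tail'' (Var g))))
     (Cond (Less (Var ''i'') (Var ''k''))
       (Set ''y'' (Sel ''lab'' (Plus (Sel ''head'' (Var g)) (Var ''n''))))
       (Set ''y'' (Sel ''lab'' (Sel ''head'' (Var g)))))"

definition MERGE :: com where
  "MERGE = For ''v'' (Plus (Var ''n'') (Var ''n''))
     (Cond (Eq (Sel ''lab'' (Var ''v'')) (Var ''y''))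
       (Assign ''lab'' (Var ''v'') (Var ''x'')) SKIP)"

text \<open>Leaving out \<open>t\<close> gives the components of the class without \<open>t\<close>,
  as the exchange test demands; a dummy \<open>t\<close> leaves out nothing.\<close>

definition LABELS :: com where
  "LABELS = Seq
     (For ''v'' (Plus (Var ''n'') (Var ''n'')) (Assign ''lab'' (Var ''v'') (Var ''v'')))
     (For ''f'' (Var ''m'')
       (Cond (Conj (Eq (Sel ''c'' (Var ''f'')) (Var ''i'')) (Neg (Eq (Var ''f'') (Var ''t''))))
         (Seq (LOAD ''f'') MERGE) SKIP))"

definition INIT :: com where
  "INIT = Seq
     (For ''f'' (Var ''m'')
       (Seq (Assign ''c'' (Var ''f'') (Var ''K'')) (Assign ''lev'' (Var ''f'') (N 1))))
     (For ''f'' (Var ''K'')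
       (Seq (Assign ''c'' (Plus (Var ''m'') (Var ''f'')) (Var ''f''))
            (Assign ''lev'' (Plus (Var ''m'') (Var ''f'')) (N 0))))"

text \<open>The value \<open>m + K\<close>, beyond all arcs and dummies, signals that no exchange
  exists.\<close>

definition SEARCH :: com where
  "SEARCH = Seq (Set ''r'' (Plus (Var ''m'') (Var ''K'')))
     (For ''t'' (Plus (Var ''m'') (Var ''K''))
       (Cond (Conj (Less (Sel ''c'' (Var ''t'')) (Var ''K''))
                   (Eq (Plus (Sel ''lev'' (Var ''t'')) (N 1)) (Sel ''lev'' (Var ''e''))))
         (Seq (Set ''i'' (Sel ''c'' (Var ''t'')))
         (Seq LABELS
         (Seq (LOAD ''e'')
           (Cond (Eq (Var ''x'') (Var ''y'')) SKIP (Set ''r'' (Var ''t''))))))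
         SKIP))"

definition STEP :: com where
  "STEP = Seq SEARCH
     (Cond (Less (Var ''r'') (Plus (Var ''m'') (Var ''K'')))
       (Seq (Assign ''c'' (Var ''e'') (Sel ''c'' (Var ''r'')))
         (Cond (Less (Var ''r'') (Var ''m'')) (Assign ''c'' (Var ''r'') (Var ''K'')) SKIP))
       (Assign ''lev'' (Var ''e'') (Plus (Sel ''lev'' (Var ''e'')) (N 1))))"

text \<open>After a step the scan restarts, because an arc before \<open>e\<close> may have been
  pushed out of its class and become active.\<close>

definition MAXIMIZE :: com where
  "MAXIMIZE = Seq (Set ''e'' (N 0))
     (While (Less (Var ''e'') (Var ''m''))
       (Cond (Conj (Eq (Sel ''c'' (Var ''e'')) (Var ''K''))
                   (Neg (Less (Var ''m'') (Sel ''lev'' (Var ''e'')))))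
         (Seq STEP (Set ''e'' (N 0)))
         (Set ''e'' (Plus (Var ''e'') (N 1)))))"

definition CHECK :: com where
  "CHECK = Cond (Eq (Sel ''lab'' (Var ''v'')) (Sel ''lab'' (N 0))) SKIP (Set ''out'' (N 0))"

text \<open>
  Setting \<open>t := m\<close> makes \<^const>\<open>LABELS\<close> leave out no arc of the class.
\<close>

definition CHECK_ALL :: com where
  "CHECK_ALL = Seq (Set ''out'' (N 1)) (Seq (Set ''t'' (Var ''m''))
     (For ''i'' (Var ''K'')
       (Seq LABELS
         (Cond (Less (Var ''i'') (Var ''k''))
           (For ''v'' (Plus (Var ''n'') (Var ''n'')) CHECK)
           (For ''v'' (Var ''n'') CHECK)))))"

text \<open>\<open>out\<close> is 0 in the input store, so a branch that does nothing answers
  no.\<close>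

definition PACKING :: com where
  "PACKING = Seq (Set ''K'' (Plus (Var ''k'') (Var ''l'')))
     (Cond (Less (Var ''n'') (N 1)) (Cond (Less (Var ''K'') (N 1)) (Set ''out'' (N 1)) SKIP)
     (Cond (Conj (Less (N 0) (Var ''k'')) (Less (Var ''n'') (N 3))) SKIP
     (Cond (Less (Var ''n'') (N 2)) (Set ''out'' (N 1))
     (Cond (Less (Var ''m'') (Var ''K'')) SKIP
       (Seq INIT (Seq MAXIMIZE CHECK_ALL))))))"

section \<open>Correctness of the subprograms\<close>

lemma writes_programs [simp]:
  "writes (LOAD g) = {''x'', ''y''}"
  "writes MERGE = {''v'', ''lab''}"
  "writes LABELS = {''v'', ''lab'', ''f'', ''x'', ''y''}"
  "writes SEARCH = {''r'', ''t'', ''i'', ''v'', ''lab'', ''f'', ''x'', ''y''}"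
  "writes STEP = {''r'', ''t'', ''i'', ''v'', ''lab'', ''f'', ''x'', ''y'', ''c'', ''lev''}"
  "writes CHECK = {''out''}"
  by (auto simp: LOAD_def MERGE_def LABELS_def SEARCH_def STEP_def CHECK_def)

text \<open>The three bounds on \<open>Z\<close> serve the loops over nodes, the loops over arcs or
  dummies or classes, and the main loop.\<close>

locale packing_instance =
  fixes D :: "(nat, nat) pre_digraph" and k l Z :: nat
  assumes inst: "(D, k, l) \<in> instances"
    and node_bound: "card (verts D) + card (verts D) \<le> Z"
    and index_bound: "card (arcs D) + (k + l) \<le> Z"
    and potential_bound: "(2 * card (arcs D) * card (arcs D) + card (arcs D)) * (card (arcs D) + 1) +
      card (arcs D) \<le> Z"
begin

abbreviation "n \<equiv> card (verts D)"
abbreviation "m \<equiv> card (arcs D)"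
abbreviation "K \<equiv> k + l"

lemma wf: "wf_digraph D" and verts: "verts D = {..<n}" and arcs: "arcs D = {..<m}"
  using inst by (auto simp: instances_def fin_digraph_def)

lemma tail_less: "f < m \<Longrightarrow> tail D f < n" and head_less: "f < m \<Longrightarrow> head D f < n"
  using wf verts arcs wf_digraph.tail_in_verts wf_digraph.head_in_verts by (metis lessThan_iff)+

sublocale matroid_packing m K "\<lambda>i S. {f. ends D k i f \<in> conn (ends D k i ` S)}"
  by (rule matroid_packing.intro) (rule closure_matroid_conn)

lemma ends_less: "f < m \<Longrightarrow> fst (ends D k i f) < n + n" "f < m \<Longrightarrow> snd (ends D k i f) < n + n"
  using tail_less[of f] head_less[of f] by (auto simp: ends_def)

definition input :: "store \<Rightarrow> bool" where
  "input s \<longleftrightarrow> s ''n'' 0 = n \<and> s ''m'' 0 = m \<and> s ''k'' 0 = k \<and> s ''K'' 0 = K \<and>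
     (\<forall>f<m. s ''tail'' f = tail D f \<and> s ''head'' f = head D f)"

lemma input_agree:
  "agree_off X s s' \<Longrightarrow> X \<inter> {''n'', ''m'', ''k'', ''K'', ''tail'', ''head''} = {} \<Longrightarrow>
     input s \<Longrightarrow> input s'"
  by (auto simp: agree_off_def input_def)

text \<open>Only the equality pattern of the labels matters. All \<open>n + n\<close> nodes are
  covered for every class; for \<open>i \<ge> k\<close> the upper half consists of isolated
  nodes.\<close>

definition labelled :: "nat \<Rightarrow> nat set \<Rightarrow> store \<Rightarrow> bool" where
  "labelled i S s \<longleftrightarrow>
     (\<forall>u < n + n. \<forall>v < n + n. s ''lab'' u = s ''lab'' v \<longleftrightarrow> (u, v) \<in> conn (ends D k i ` S))"

lemma wp_LOAD:
  assumes "input s" "s g 0 < m" "g \<noteq> ''x''"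
    and "Q (s(''x'' := (s ''x'')(0 := s ''lab'' (fst (ends D k (s ''i'' 0) (s g 0)))),
              ''y'' := (s ''y'')(0 := s ''lab'' (snd (ends D k (s ''i'' 0) (s g 0))))))"
  shows "wp Z (LOAD g) Q s"
  unfolding LOAD_def
  by (intro wp_Seq wp_Cond wp_Assign) (use assms in \<open>auto simp: input_def ends_def\<close>)

lemma wp_MERGE:
  assumes s: "input s"
    and post: "\<And>s'. agree_off {''v'', ''lab''} s s' \<Longrightarrow>
      (\<forall>v < n + n. s' ''lab'' v = (if s ''lab'' v = s ''y'' 0 then s ''x'' 0 else s ''lab'' v)) \<Longrightarrow> Q s'"
  shows "wp Z MERGE Q s"
  unfolding MERGE_def
proof (rule wp_For[where M = "n + n" and I = "\<lambda>j s'. \<forall>v. s' ''lab'' v =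
    (if v < j \<and> s ''lab'' v = s ''y'' 0 then s ''x'' 0 else s ''lab'' v)"], goal_cases)
  case (4 s')
  then have "input s'" by (rule input_agree) (use s in auto)
  then show ?case by (simp add: input_def)
next
  case (6 j s')
  have "s' ''x'' = s ''x''" "s' ''y'' = s ''y''" using 6(4) by (auto simp: agree_off_def)
  with 6(2,3) show ?case by (intro wp_Cond wp_Assign wp_SKIP) (auto simp: less_Suc_eq)
next
  case (7 s')
  then show ?case by (intro post) (auto simp: agree_off_def)
qed (use node_bound in auto)

lemma wp_LABELS:
  assumes s: "input s"
  shows "wp Z LABELS (labelled (s ''i'' 0) (colour_class (s ''c'') (s ''i'' 0) - {s ''t'' 0})) s"
  unfolding LABELS_def
proof (rule wp_Seq)
  let ?i = "s ''i'' 0" and ?t = "s ''t'' 0"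
  let ?S = "\<lambda>j. {f. f < j \<and> s ''c'' f = ?i \<and> f \<noteq> ?t}"
  let ?Q = "labelled ?i (colour_class (s ''c'') ?i - {?t})"
  show "wp Z (For ''v'' (Plus (Var ''n'') (Var ''n'')) (Assign ''lab'' (Var ''v'') (Var ''v'')))
    (wp Z (For ''f'' (Var ''m'')
       (Cond (Conj (Eq (Sel ''c'' (Var ''f'')) (Var ''i'')) (Neg (Eq (Var ''f'') (Var ''t''))))
         (Seq (LOAD ''f'') MERGE) SKIP)) ?Q) s" (is "wp Z _ (wp Z ?loop ?Q) s")
  proof (rule wp_For[where M = "n + n" and I = "\<lambda>j s'. \<forall>v<j. s' ''lab'' v = v"], goal_cases)
    case (4 s')
    then have "input s'" by (rule input_agree) (use s in auto)
    then show ?case by (simp add: input_def)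
  next
    case (6 j s')
    then show ?case by (intro wp_Assign) (auto simp: less_Suc_eq)
  next
    case (7 s1)
    have s1: "input s1" "s1 ''c'' = s ''c''" "s1 ''i'' = s ''i''" "s1 ''t'' = s ''t''"
      using input_agree[OF 7(2)] s 7(2) by (auto simp: agree_off_def)
    show ?case
    proof (rule wp_For[where M = m and I = "\<lambda>j. labelled ?i (?S j)"], goal_cases)
      case 1
      then show ?case using 7(1) by (auto simp: labelled_def conn_def)
    next
      case 2
      then show ?case by simp
    next
      case (3 j s v)
      then show ?case by (simp add: labelled_def)
    next
      case (4 s')
      then have "input s'" by (rule input_agree) (use s1 in auto)
      then show ?case by (simp add: input_def)
    next
      case 5
      then show ?case using index_bound by simp
    next
      case (6 j s')
      have s': "input s'" by (rule input_agree[OF 6(4)]) (use s1 in auto)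
      have fr: "s' ''c'' = s ''c''" "s' ''i'' = s ''i''" "s' ''t'' = s ''t''"
        using 6(4) s1 by (auto simp: agree_off_def)
      show ?case
      proof (rule wp_Cond)
        assume b: "bval (Conj (Eq (Sel ''c'' (Var ''f'')) (Var ''i'')) (Neg (Eq (Var ''f'') (Var ''t'')))) s'"
        then have S: "?S (Suc j) = insert j (?S j)" using fr 6(3) by (auto simp: less_Suc_eq)
        obtain a b where ab: "ends D k ?i j = (a, b)" by fastforce
        have less: "a < n + n" "b < n + n" using ends_less[OF 6(1), of ?i] ab by auto
        show "wp Z (Seq (LOAD ''f'') MERGE) (labelled ?i (?S (Suc j))) s'"
        proof (rule wp_Seq, rule wp_LOAD, goal_cases)
          case 4
          show ?case
          proof (rule wp_MERGE, goal_cases)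
            case 1
            then show ?case using s' by (simp add: input_def)
          next
            case (2 s2)
            have lab: "s2 ''lab'' v = (if s' ''lab'' v = s' ''lab'' b then s' ''lab'' a else s' ''lab'' v)"
              if "v < n + n" for v
              using 2(2) that fr 6(3) ab by simp
            have conn: "s' ''lab'' u = s' ''lab'' v \<longleftrightarrow> (u, v) \<in> conn (ends D k ?i ` ?S j)"
              if "u < n + n" "v < n + n" for u v
              using 6(2) that by (simp add: labelled_def)
            have "s2 ''lab'' u = s2 ''lab'' v \<longleftrightarrow> (u, v) \<in> conn (ends D k ?i ` ?S (Suc j))"
              if "u < n + n" "v < n + n" for u v
              \<comment> \<open>Renaming the label of \<open>b\<close> to that of \<open>a\<close>
                matches the alternatives for a connection after the edge from \<open>a\<close> to
                \<open>b\<close> has been added.\<close>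
              unfolding S image_insert ab conn_insert
              using that less by (auto simp: lab conn[symmetric])
            then show ?case by (simp add: labelled_def)
          qed
        qed (use s' 6 in auto)
      next
        assume b: "\<not> bval (Conj (Eq (Sel ''c'' (Var ''f'')) (Var ''i'')) (Neg (Eq (Var ''f'') (Var ''t'')))) s'"
        then have "?S (Suc j) = ?S j" using fr 6(3) by (auto simp: less_Suc_eq)
        then show "wp Z SKIP (labelled ?i (?S (Suc j))) s'" using 6(2) by (simp add: wp_SKIP)
      qed
    next
      case (7 s')
      moreover have "?S m = colour_class (s ''c'') ?i - {?t}" by (auto simp: colour_class_def)
      ultimately show ?case by simp
    qed
  qed (use node_bound in auto)
qed

lemma wp_INIT:
  assumes s: "input s"
    and post: "\<And>s'. input s' \<Longrightarrow> valid (s' ''c'') (s' ''lev'') \<Longrightarrow>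
      potential (s' ''c'') (s' ''lev'') \<le> 2 * m * m + m \<Longrightarrow> Q s'"
  shows "wp Z INIT Q s"
  unfolding INIT_def
proof (rule wp_Seq,
    rule wp_For[where M = m and I = "\<lambda>j s'. \<forall>f<j. s' ''c'' f = K \<and> s' ''lev'' f = 1"], goal_cases)
  case (4 s')
  then have "input s'" by (rule input_agree) (use s in auto)
  then show ?case by (simp add: input_def)
next
  case (6 j s')
  have "input s'" by (rule input_agree[OF 6(4)]) (use s in auto)
  then show ?case by (intro wp_Seq wp_Assign) (use 6(2,3) in \<open>auto simp: input_def less_Suc_eq\<close>)
next
  case (7 s1)
  have s1: "input s1" by (rule input_agree[OF 7(2)]) (use s in auto)
  show ?case
  proof (rule wp_For[where M = K and I = "\<lambda>j s'. (\<forall>f<m. s' ''c'' f = K \<and> s' ''lev'' f = 1) \<and>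
      (\<forall>i<j. s' ''c'' (m + i) = i \<and> s' ''lev'' (m + i) = 0)"], goal_cases)
    case (4 s')
    then have "input s'" by (rule input_agree) (use s1 in auto)
    then show ?case by (simp add: input_def)
  next
    case (6 j s')
    have "input s'" by (rule input_agree[OF 6(4)]) (use s1 in auto)
    then show ?case by (intro wp_Seq wp_Assign) (use 6(2,3) in \<open>auto simp: input_def less_Suc_eq\<close>)
  next
    case (7 s')
    have "input s'" by (rule input_agree[OF 7(2)]) (use s1 in auto)
    with 7(1) show ?case by (intro post valid_init potential_init) auto
  qed (use 7(1) index_bound in auto)
qed (use index_bound in auto)

lemma wp_SEARCH:
  assumes s: "input s" "s ''e'' 0 = e" "e < m"
    and post: "\<And>s'. agree_off (writes SEARCH) s s' \<Longrightarrow>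
      (s' ''r'' 0 < m + K \<and> exchangeable (s ''c'') (s ''lev'') e (s' ''r'' 0)) \<or>
      (s' ''r'' 0 = m + K \<and> \<not> (\<exists>t. exchangeable (s ''c'') (s ''lev'') e t)) \<Longrightarrow> Q s'"
  shows "wp Z SEARCH Q s"
  unfolding SEARCH_def
proof (rule wp_Seq, rule wp_Assign)
  let ?ex = "exchangeable (s ''c'') (s ''lev'') e"
  let ?s = "s(''r'' := (s ''r'')(aval (N 0) s := aval (Plus (Var ''m'') (Var ''K'')) s))"
  let ?I = "\<lambda>j s'. (s' ''r'' 0 < m + K \<and> ?ex (s' ''r'' 0)) \<or>
    (s' ''r'' 0 = m + K \<and> (\<forall>t<j. \<not> ?ex t))"
  have s0: "input ?s" using s(1) by (simp add: input_def)
  let ?cond = "Conj (Less (Sel ''c'' (Var ''t'')) (Var ''K''))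
    (Eq (Plus (Sel ''lev'' (Var ''t'')) (N 1)) (Sel ''lev'' (Var ''e'')))"
  let ?test = "Seq (Set ''i'' (Sel ''c'' (Var ''t'')))
         (Seq LABELS (Seq (LOAD ''e'') (Cond (Eq (Var ''x'') (Var ''y'')) SKIP (Set ''r'' (Var ''t'')))))"
  show "wp Z (For ''t'' (Plus (Var ''m'') (Var ''K'')) (Cond ?cond ?test SKIP)) Q ?s"
  proof (rule wp_For[where M = "m + K" and I = ?I], goal_cases)
    case 1
    then show ?case using s by (simp add: input_def)
  next
    case (4 s')
    then have "input s'" by (rule input_agree) (use s0 in auto)
    then show ?case by (simp add: input_def)
  next
    case (6 j s1)
    have s1: "input s1" by (rule input_agree[OF 6(4)]) (use s0 in auto)
    have fr: "s1 ''c'' = s ''c''" "s1 ''lev'' = s ''lev''" "s1 ''e'' 0 = e"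
      using 6(4) s(2) by (auto simp: agree_off_def)
    show ?case
    proof (rule wp_Cond)
      assume b: "bval ?cond s1"
      let ?i = "s ''c'' j"
      have ij: "?i < K" "s ''lev'' j + 1 = s ''lev'' e" using b fr s1 6(3) by (auto simp: input_def)
      let ?s2 = "s1(''i'' := (s1 ''i'')(aval (N 0) s1 := aval (Sel ''c'' (Var ''t'')) s1))"
      have s2: "input ?s2" using s1 by (simp add: input_def)
      show "wp Z ?test (?I (Suc j)) s1"
      proof (rule wp_Seq, rule wp_Assign, rule wp_Seq, rule wp_mono[OF wp_frame[OF wp_LABELS[OF s2]]])
        fix s3 assume "labelled (?s2 ''i'' 0) (colour_class (?s2 ''c'') (?s2 ''i'' 0) - {?s2 ''t'' 0}) s3 \<and>
          agree_off (writes LABELS) ?s2 s3"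
        then have lab: "labelled ?i (colour_class (s ''c'') ?i - {j}) s3"
          and ag: "agree_off (writes LABELS) ?s2 s3"
          using fr 6(3) by auto
        have s3: "input s3" by (rule input_agree[OF ag]) (use s2 in auto)
        have fr3: "s3 ''i'' 0 = ?i" "s3 ''r'' = s1 ''r''" "s3 ''t'' 0 = j" "s3 ''e'' 0 = e"
          using ag fr 6(3) by (auto simp: agree_off_def)
        \<comment> \<open>Equal labels mean that the class without \<open>j\<close> spans
          \<open>e\<close>, so the exchange would destroy independence.\<close>
        have ex: "s3 ''lab'' (fst (ends D k ?i e)) = s3 ''lab'' (snd (ends D k ?i e)) \<longleftrightarrow> \<not> ?ex j"
          using lab ij 6(1) ends_less[OF s(3)] by (simp add: labelled_def exchangeable_def)
        show "wp Z (Seq (LOAD ''e'') (Cond (Eq (Var ''x'') (Var ''y'')) SKIP (Set ''r'' (Var ''t''))))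
          (?I (Suc j)) s3"
        proof (rule wp_Seq, rule wp_LOAD[OF s3], goal_cases)
          case 3
          show ?case
            by (intro wp_Cond wp_SKIP wp_Assign)
              (use fr3 ex 6(1,2) in \<open>auto simp: less_Suc_eq\<close>)
        qed (use fr3 s(3) in auto)
      qed
    next
      assume "\<not> bval ?cond s1"
      then have "\<not> ?ex j" using fr s1 6(3) by (auto simp: input_def exchangeable_def)
      with 6(2) show "wp Z SKIP (?I (Suc j)) s1" by (intro wp_SKIP) (auto simp: less_Suc_eq)
    qed
  next
    case (7 s')
    have "agree_off (writes SEARCH) s s'" using 7(2) by (auto simp: agree_off_def)
    moreover have "\<not> ?ex t" if "\<forall>t<m + K. \<not> ?ex t" for t
      using that by (cases "t < m + K") (auto simp: exchangeable_def)
    ultimately show ?case using 7(1) by (intro post) blast+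
  qed (use index_bound in auto)
qed

lemma wp_STEP:
  assumes s: "input s" "s ''e'' 0 = e" "e < m" "valid (s ''c'') (s ''lev'')"
    "active (s ''c'') (s ''lev'') e"
  shows "wp Z STEP (\<lambda>s'. valid (s' ''c'') (s' ''lev'') \<and>
    potential (s' ''c'') (s' ''lev'') < potential (s ''c'') (s ''lev'')) s"
    (is "wp Z STEP ?Q s")
  unfolding STEP_def
proof (rule wp_Seq, rule wp_SEARCH[OF s(1-3)])
  fix s1
  let ?ex = "exchangeable (s ''c'') (s ''lev'') e"
  assume ag: "agree_off (writes SEARCH) s s1"
    and r: "(s1 ''r'' 0 < m + K \<and> ?ex (s1 ''r'' 0)) \<or> (s1 ''r'' 0 = m + K \<and> \<not> (\<exists>t. ?ex t))"
  have s1: "input s1" by (rule input_agree[OF ag]) (use s(1) in auto)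
  have fr: "s1 ''c'' = s ''c''" "s1 ''lev'' = s ''lev''" "s1 ''e'' 0 = e"
    using ag s(2) by (auto simp: agree_off_def)
  let ?r = "s1 ''r'' 0"
  have m: "s1 ''m'' 0 = m" "s1 ''K'' 0 = K" using s1 by (auto simp: input_def)
  show "wp Z (Cond (Less (Var ''r'') (Plus (Var ''m'') (Var ''K'')))
       (Seq (Assign ''c'' (Var ''e'') (Sel ''c'' (Var ''r'')))
         (Cond (Less (Var ''r'') (Var ''m'')) (Assign ''c'' (Var ''r'') (Var ''K'')) SKIP))
       (Assign ''lev'' (Var ''e'') (Plus (Sel ''lev'' (Var ''e'')) (N 1)))) ?Q s1"
  proof (rule wp_Cond)
    assume "bval (Less (Var ''r'') (Plus (Var ''m'') (Var ''K''))) s1"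
    then have "?ex ?r" using r m by auto
    with valid_push[OF s(4,3,5)] potential_push[OF s(4,3,5)]
    have "valid (push (s ''c'') e ?r) (s ''lev'')"
      "potential (push (s ''c'') e ?r) (s ''lev'') < potential (s ''c'') (s ''lev'')" by blast+
    then show "wp Z (Seq (Assign ''c'' (Var ''e'') (Sel ''c'' (Var ''r'')))
         (Cond (Less (Var ''r'') (Var ''m'')) (Assign ''c'' (Var ''r'') (Var ''K'')) SKIP)) ?Q s1"
      by (intro wp_Seq wp_Cond wp_Assign wp_SKIP) (simp_all add: fr m push_def)
  next
    assume "\<not> bval (Less (Var ''r'') (Plus (Var ''m'') (Var ''K''))) s1"
    then have "\<not> (\<exists>t. ?ex t)" using r m by auto
    with valid_relabel[OF s(4,3,5)] potential_relabel[OF s(4,3,5)]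
    have "valid (s ''c'') ((s ''lev'')(e := s ''lev'' e + 1))"
      "potential (s ''c'') ((s ''lev'')(e := s ''lev'' e + 1)) < potential (s ''c'') (s ''lev'')"
      by blast+
    then show "wp Z (Assign ''lev'' (Var ''e'') (Plus (Sel ''lev'' (Var ''e'')) (N 1))) ?Q s1"
      by (intro wp_Assign) (simp_all add: fr m)
  qed
qed

lemma wp_MAXIMIZE:
  assumes s: "input s" "valid (s ''c'') (s ''lev'')"
    "potential (s ''c'') (s ''lev'') \<le> 2 * m * m + m"
    and post: "\<And>s'. input s' \<Longrightarrow> valid (s' ''c'') (s' ''lev'') \<Longrightarrow>
      \<forall>e<m. \<not> active (s' ''c'') (s' ''lev'') e \<Longrightarrow> Q s'"
  shows "wp Z MAXIMIZE Q s"
  unfolding MAXIMIZE_def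
proof (rule wp_Seq, rule wp_Assign)
  let ?s = "s(''e'' := (s ''e'')(aval (N 0) s := aval (N 0) s))"
  let ?I = "\<lambda>s'. input s' \<and> valid (s' ''c'') (s' ''lev'') \<and> s' ''e'' 0 \<le> m \<and>
    (\<forall>e<s' ''e'' 0. \<not> active (s' ''c'') (s' ''lev'') e)"
  \<comment> \<open>The lexicographic order of potential and remaining scan, coded in one number: as
    \<open>m - e \<le> m\<close>, the weight \<open>m + 1\<close> lets a drop of the potential pay
    for the restart.\<close>
  let ?f = "\<lambda>s'. potential (s' ''c'') (s' ''lev'') * (m + 1) + (m - s' ''e'' 0)"
  let ?cond = "Conj (Eq (Sel ''c'' (Var ''e'')) (Var ''K'')) (Neg (Less (Var ''m'') (Sel ''lev'' (Var ''e''))))"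
  show "wp Z (While (Less (Var ''e'') (Var ''m''))
       (Cond ?cond (Seq STEP (Set ''e'' (N 0))) (Set ''e'' (Plus (Var ''e'') (N 1))))) Q ?s"
  proof (rule wp_While[where I = ?I and f = ?f])
    show "?I ?s" using s by (simp add: input_def)
    have "potential (s ''c'') (s ''lev'') * (m + 1) \<le> (2 * m * m + m) * (m + 1)"
      using s(3) by (rule mult_right_mono) simp
    then show "?f ?s \<le> Z" using potential_bound by simp
  next
    fix s1 assume I: "?I s1" and b: "bval (Less (Var ''e'') (Var ''m'')) s1"
    let ?e = "s1 ''e'' 0"
    have e: "?e < m" using I b by (simp add: input_def)
    have cond: "bval ?cond s1 \<longleftrightarrow> active (s1 ''c'') (s1 ''lev'') ?e"
      using I by (auto simp: input_def active_def)
    show "wp Z (Cond ?cond (Seq STEP (Set ''e'' (N 0))) (Set ''e'' (Plus (Var ''e'') (N 1))))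
      (\<lambda>s'. ?I s' \<and> ?f s' < ?f s1) s1"
    proof (rule wp_Cond)
      assume "bval ?cond s1"
      with cond e I have wp: "wp Z STEP (\<lambda>s'. valid (s' ''c'') (s' ''lev'') \<and>
          potential (s' ''c'') (s' ''lev'') < potential (s1 ''c'') (s1 ''lev'')) s1"
        by (intro wp_STEP[where e = ?e]) auto
      show "wp Z (Seq STEP (Set ''e'' (N 0))) (\<lambda>s'. ?I s' \<and> ?f s' < ?f s1) s1"
      proof (rule wp_Seq, rule wp_mono[OF wp_frame[OF wp]], rule wp_Assign)
        fix s2 assume s2: "(valid (s2 ''c'') (s2 ''lev'') \<and>
          potential (s2 ''c'') (s2 ''lev'') < potential (s1 ''c'') (s1 ''lev'')) \<and>
          agree_off (writes STEP) s1 s2"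
        have "input s2" by (rule input_agree[of "writes STEP" s1]) (use s2 I in auto)
        then have input: "input (s2(''e'' := (s2 ''e'')(0 := 0)))" by (simp add: input_def)
        have "Suc (potential (s2 ''c'') (s2 ''lev'')) * (m + 1) \<le>
            potential (s1 ''c'') (s1 ''lev'') * (m + 1)"
          using s2 by (intro mult_right_mono) auto
        then have "potential (s2 ''c'') (s2 ''lev'') * (m + 1) + m <
            potential (s1 ''c'') (s1 ''lev'') * (m + 1)" by simp
        with s2 input show "?I (s2(''e'' := (s2 ''e'')(aval (N 0) s2 := aval (N 0) s2))) \<and>
            ?f (s2(''e'' := (s2 ''e'')(aval (N 0) s2 := aval (N 0) s2))) < ?f s1"
          by simp
      qed
    next
      assume "\<not> bval ?cond s1"
      with cond have inactive: "\<not> active (s1 ''c'') (s1 ''lev'') ?e" by simp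
      show "wp Z (Set ''e'' (Plus (Var ''e'') (N 1))) (\<lambda>s'. ?I s' \<and> ?f s' < ?f s1) s1"
        by (rule wp_Assign) (use I e inactive in \<open>auto simp: input_def less_Suc_eq\<close>)
    qed
  next
    fix s1 assume I: "?I s1" and b: "\<not> bval (Less (Var ''e'') (Var ''m'')) s1"
    then have "s1 ''e'' 0 = m" by (simp add: input_def)
    with I show "Q s1" by (intro post) auto
  qed
qed

text \<open>\<open>P\<close> stands for the verdict on the classes checked before.\<close>

lemma wp_CHECK_loop:
  assumes lab: "labelled i S s" and out: "s ''out'' 0 = (if P then 1 else 0)"
    and limit: "\<And>s'. agree_off {''v'', ''out''} s s' \<Longrightarrow> aval a s' = num_nodes D k i"
  shows "wp Z (For ''v'' a CHECK)
    (\<lambda>s'. s' ''out'' 0 = (if P \<and> spans D k i S then 1 else 0)) s"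
proof (rule wp_For[where M = "num_nodes D k i" and I = "\<lambda>j s'. s' ''out'' 0 =
    (if P \<and> (\<forall>v<j. s ''lab'' v = s ''lab'' 0) then 1 else 0)"], goal_cases)
  case (4 s')
  then show ?case by (intro limit) simp
next
  case 5
  show ?case using node_bound by (simp add: num_nodes_def)
next
  case (6 j s')
  have "s' ''lab'' = s ''lab''" using 6(4) by (auto simp: agree_off_def)
  with 6(2,3) show ?case unfolding CHECK_def
    by (intro wp_Cond wp_Assign wp_SKIP) (auto simp: less_Suc_eq)
next
  case (7 s')
  have le: "num_nodes D k i \<le> n + n" by (simp add: num_nodes_def)
  have "s ''lab'' v = s ''lab'' 0 \<longleftrightarrow> (0, v) \<in> conn (ends D k i ` S)" if "v < num_nodes D k i" for v
  proof -
    have "0 < n + n" "v < n + n" using that le by auto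
    then have "s ''lab'' 0 = s ''lab'' v \<longleftrightarrow> (0, v) \<in> conn (ends D k i ` S)"
      using lab unfolding labelled_def by blast
    then show ?thesis by metis
  qed
  then have "(\<forall>v<num_nodes D k i. s ''lab'' v = s ''lab'' 0) \<longleftrightarrow> spans D k i S"
    by (auto simp: spans_def)
  with 7(1) show ?case by simp
qed (use out in auto)

lemma wp_CHECK_ALL:
  assumes s: "input s"
  shows "wp Z CHECK_ALL (\<lambda>s'. s' ''out'' 0 =
    (if \<forall>i<K. spans D k i (colour_class (s ''c'') i) then 1 else 0)) s"
  unfolding CHECK_ALL_def
proof (rule wp_Seq, rule wp_Assign, rule wp_Seq, rule wp_Assign)
  let ?P = "\<lambda>i. spans D k i (colour_class (s ''c'') i)"
  let ?I = "\<lambda>j s'. s' ''out'' 0 = (if \<forall>i<j. ?P i then 1 else 0)"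
  let ?t = "s(''out'' := (s ''out'')(aval (N 0) s := aval (N 1) s))"
  let ?s = "?t(''t'' := (?t ''t'')(aval (N 0) ?t := aval (Var ''m'') ?t))"
  let ?check = "Cond (Less (Var ''i'') (Var ''k''))
    (For ''v'' (Plus (Var ''n'') (Var ''n'')) CHECK) (For ''v'' (Var ''n'') CHECK)"
  have s0: "input ?s" using s by (simp add: input_def)
  show "wp Z (For ''i'' (Var ''K'') (Seq LABELS ?check)) (?I K) ?s"
  proof (rule wp_For[where M = K and I = ?I], goal_cases)
    case (4 s')
    then have "input s'" by (rule input_agree) (use s0 in auto)
    then show ?case by (simp add: input_def)
  next
    case (6 j s1)
    have s1: "input s1" by (rule input_agree[OF 6(4)]) (use s0 in auto)
    have fr: "s1 ''c'' = s ''c''" "s1 ''t'' 0 = m"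
      using 6(4) s by (auto simp: agree_off_def input_def)
    show ?case
    proof (rule wp_Seq, rule wp_mono[OF wp_frame[OF wp_LABELS[OF s1]]])
      fix s2
      assume "labelled (s1 ''i'' 0) (colour_class (s1 ''c'') (s1 ''i'' 0) - {s1 ''t'' 0}) s2 \<and>
        agree_off (writes LABELS) s1 s2"
      moreover have "colour_class (s ''c'') j - {m} = colour_class (s ''c'') j"
        by (auto simp: colour_class_def)
      ultimately have lab: "labelled j (colour_class (s ''c'') j) s2"
        and ag: "agree_off (writes LABELS) s1 s2"
        using fr 6(3) by auto
      have s2: "input s2" by (rule input_agree[OF ag]) (use s1 in auto)
      have i: "s2 ''i'' 0 = j" and out: "?I j s2" using ag 6(2,3) by (auto simp: agree_off_def)
      have upd: "(\<forall>i<Suc j. ?P i) \<longleftrightarrow> (\<forall>i<j. ?P i) \<and> ?P j" by (auto simp: less_Suc_eq)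
      have n: "s' ''n'' 0 = n" if "agree_off {''v'', ''out''} s2 s'" for s'
        using s2 that by (auto simp: input_def agree_off_def)
      show "wp Z ?check (?I (Suc j)) s2"
        unfolding upd
        by (intro wp_Cond wp_CHECK_loop[OF lab out])
          (use s2 i n in \<open>auto simp: num_nodes_def input_def\<close>)
    qed
  qed (use index_bound in auto)
qed

text \<open>If some packing exists, its members span all arcs; by optimality so do the colour
  classes, which then inherit the connection of all nodes from the \<open>J i\<close>.\<close>

lemma packing_spans_iff:
  assumes n: "2 \<le> n" "k = 0 \<or> 3 \<le> n"
    and c: "valid c lv" "\<forall>e<m. \<not> active c lv e"
  shows "has_arc_disjoint_subdigraphs D k l \<longleftrightarrow> (\<forall>i<K. spans D k i (colour_class c i))"
  unfolding has_arc_disjoint_subdigraphs_iff[OF wf verts n]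
proof
  assume "\<exists>J. (\<forall>i<K. J i \<subseteq> arcs D \<and> spans D k i (J i)) \<and> disjoint_family_on J {..<K}"
  then obtain J where J: "\<And>i. i < K \<Longrightarrow> J i \<subseteq> arcs D" "\<And>i. i < K \<Longrightarrow> spans D k i (J i)"
    "disjoint_family_on J {..<K}" by blast
  have conn: "{..<m} \<subseteq> {f. ends D k i f \<in> conn (ends D k i ` J i)}" if "i < K" for i
    using conn_if_spans[OF J(2)[OF that] wf verts] arcs by blast
  show "\<forall>i<K. spans D k i (colour_class c i)"
  proof (intro allI impI)
    fix i assume i: "i < K"
    have "{..<m} \<subseteq> {f. ends D k i f \<in> conn (ends D k i ` colour_class c i)}"
      using c(2) J(1) arcs by (intro spanning_if_packing[OF c(1) _ _ J(3) conn i]) auto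
    then show "spans D k i (colour_class c i)"
      using spans_mono_conn[OF J(2)[OF i]] J(1)[OF i] arcs by blast
  qed
next
  assume "\<forall>i<K. spans D k i (colour_class c i)"
  then show "\<exists>J. (\<forall>i<K. J i \<subseteq> arcs D \<and> spans D k i (J i)) \<and> disjoint_family_on J {..<K}"
    using arcs by (intro exI[of _ "colour_class c"]) (auto simp: colour_class_def disjoint_family_on_def)
qed

lemma wp_packing:
  assumes s: "input s" and n: "2 \<le> n" "k = 0 \<or> 3 \<le> n"
  shows "wp Z (Seq INIT (Seq MAXIMIZE CHECK_ALL))
    (\<lambda>s'. s' ''out'' 0 = (if has_arc_disjoint_subdigraphs D k l then 1 else 0)) s"
proof (rule wp_Seq, rule wp_INIT[OF s], rule wp_Seq, erule (2) wp_MAXIMIZE)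
  fix s' assume s': "input s'" "valid (s' ''c'') (s' ''lev'')"
    "\<forall>e<m. \<not> active (s' ''c'') (s' ''lev'') e"
  show "wp Z CHECK_ALL
    (\<lambda>s'. s' ''out'' 0 = (if has_arc_disjoint_subdigraphs D k l then 1 else 0)) s'"
    using wp_CHECK_ALL[OF s'(1)] unfolding packing_spans_iff[OF n s'(2,3)] .
qed

end

lemma wp_PACKING:
  fixes sz :: nat
  assumes inst: "(D, k, l) \<in> instances"
    and sz: "card (verts D) \<le> sz" "card (arcs D) \<le> sz"
    and Z: "Z = (2 * sz * sz + sz) * (sz + 1) + 2 * sz"
  shows "wp Z PACKING (\<lambda>s. s ''out'' 0 = (if has_arc_disjoint_subdigraphs D k l then 1 else 0))
    (instance_store (D, k, l))"
    (is "wp Z PACKING ?Q ?s")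
proof -
  let ?n = "card (verts D)" and ?m = "card (arcs D)"
  let ?s1 = "?s(''K'' := (?s ''K'')(0 := k + l))"
  have D: "wf_digraph D" "finite (verts D)" "finite (arcs D)" "verts D = {..<?n}"
    using inst by (auto simp: instances_def fin_digraph_def fin_digraph_axioms_def)
  have mem: "f \<in> arcs D \<longleftrightarrow> f < ?m" for f using inst by (auto simp: instances_def)
  note few = has_arc_disjoint_subdigraphs_few_verts[OF D(1,2)]
  have main: "wp Z (Seq INIT (Seq MAXIMIZE CHECK_ALL)) ?Q ?s1"
    if n: "2 \<le> ?n" "k = 0 \<or> 3 \<le> ?n" and K: "k + l \<le> ?m"
  proof -
    have "(2 * ?m * ?m + ?m) * (?m + 1) \<le> (2 * sz * sz + sz) * (sz + 1)"
      using sz by (intro mult_mono add_mono) auto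
    \<comment> \<open>The summand \<open>2 * sz\<close> in \<open>Z\<close> covers the
      \<open>n + n\<close> nodes, the at most \<open>m + m\<close> arcs and dummies, and the extra
      \<open>m\<close> in the variant of the main loop.\<close>
    then interpret packing_instance D k l Z
      using inst sz K Z by unfold_locales auto
    show ?thesis by (intro wp_packing n) (auto simp: input_def mem)
  qed
  have too_many: "\<not> has_arc_disjoint_subdigraphs D k l"
    if n: "2 \<le> ?n" "k = 0 \<or> 3 \<le> ?n" and K: "?m < k + l"
    using card_le_if_spans[of "k + l" _ D k] D(3) n(1) K
    unfolding has_arc_disjoint_subdigraphs_iff[OF D(1,4) n] by fastforce
  show ?thesis
    unfolding PACKING_def
  proof (rule wp_Seq, rule wp_Assign)
    have "?s(''K'' := (?s ''K'')(aval (N 0) ?s := aval (Plus (Var ''k'') (Var ''l'')) ?s)) = ?s1"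
      by simp
    then show "wp Z (Cond (Less (Var ''n'') (N 1)) (Cond (Less (Var ''K'') (N 1)) (Set ''out'' (N 1)) SKIP)
     (Cond (Conj (Less (N 0) (Var ''k'')) (Less (Var ''n'') (N 3))) SKIP
     (Cond (Less (Var ''n'') (N 2)) (Set ''out'' (N 1))
     (Cond (Less (Var ''m'') (Var ''K'')) SKIP
       (Seq INIT (Seq MAXIMIZE CHECK_ALL)))))) ?Q
      (?s(''K'' := (?s ''K'')(aval (N 0) ?s := aval (Plus (Var ''k'') (Var ''l'')) ?s)))"
      by (simp only:, intro wp_Cond wp_SKIP wp_Assign main) (use few too_many in auto)
  qed
qed

theorem theorem8p3:
  shows "\<exists>c :: com. decides_in_poly_time c instances instance_store instance_size
           (\<lambda>(D, k, l). has_arc_disjoint_subdigraphs D k l)"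
proof -
  obtain p :: "nat poly" where p: "\<And>Z. time_bound Z PACKING = poly p Z"
    using time_bound_poly by blast
  \<comment> \<open>The identity polynomial: \<open>?Z\<close> is the loop bound of
    \<open>wp_PACKING\<close> as a polynomial in the instance size, to be composed with the time
    bound \<open>p\<close>.\<close>
  let ?q = "[:0, 1:] :: nat poly"
  let ?Z = "(2 * ?q * ?q + ?q) * (?q + 1) + 2 * ?q"
  have Z: "poly ?Z z = (2 * z * z + z) * (z + 1) + 2 * z" for z by (simp add: algebra_simps)
  have "\<exists>t s. exec PACKING (instance_store x) t s \<and> t \<le> poly (p \<circ>\<^sub>p ?Z) (instance_size x) \<and>
      s ''out'' 0 = (if (\<lambda>(D, k, l). has_arc_disjoint_subdigraphs D k l) x then 1 else 0)"
    if x: "x \<in> instances" for x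
  proof -
    obtain D k l where eq: "x = (D, k, l)" by (cases x) auto
    let ?z = "instance_size x"
    have "wp (poly ?Z ?z) PACKING
        (\<lambda>s. s ''out'' 0 = (if has_arc_disjoint_subdigraphs D k l then 1 else 0)) (instance_store x)"
      using x unfolding eq by (intro wp_PACKING[OF _ _ _ Z]) simp_all
    then show ?thesis
      unfolding wp_def p by (simp add: eq poly_pcompose)
  qed
  then show ?thesis unfolding decides_in_poly_time_def by blast
qed

end
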